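(* Let $(\mathcal{X},d)$ be Polish. Let $\pi\in\Pi(\mu,\nu)$ and $\tilde\pi\in\Pi(\tilde\mu,\tilde\nu)$ be Borel probability measures on $\mathcal{X}^2$ whose marginals all have finite first moments. Then $$\left|\int\mathcal{W}(\pi_{x_1},\nu)\,\mu(dx_1)-\int\mathcal{W}(\tilde\pi_{y_1},\tilde\nu)\,\tilde\mu(dy_1)\right|\le\mathcal{AW}(\pi,\tilde\pi)+\mathcal{W}(\nu,\tilde\nu)\le2\,\mathcal{AW}(\pi,\tilde\pi).$$ If moreover $\nu$ and $\tilde\nu$ are not Dirac measures, then $$\left|\overrightarrow{\mathcal{W}}(\pi)-\overrightarrow{\mathcal{W}}(\tilde\pi)\right|\le\frac{\mathcal{AW}(\pi,\tilde\pi)+\mathcal{W}(\nu,\tilde\nu)+g(\nu,\tilde\nu)}{f(\tilde\nu)}\le\frac{\mathcal{AW}(\pi,\tilde\pi)+3\mathcal{W}(\nu,\tilde\nu)}{f(\tilde\nu)}\le\frac{4\,\mathcal{AW}(\pi,\tilde\pi)}{f(\tilde\nu)},$$ where $f(\tilde\nu)=\int\int d(y,z)\,\tilde\nu(dy)\tilde\nu(dz)$ and $g(\nu,\tilde\nu)=\left|\int\int d(y,z)\,\tilde\nu(dy)\tilde\nu(dz)-\int\int d(y,z)\,\nu(dy)\nu(dz)\right|$.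
   Context: $\Pi(\alpha,\beta)$ denotes couplings of $\alpha,\beta$; $\pi_{x_1}$ (resp. $\tilde\pi_{y_1}$) is the disintegration of $\pi$ (resp. $\tilde\pi$) w.r.t. the first coordinate. $\mathcal{W}(\alpha,\beta)=\inf_{\gamma\in\Pi(\alpha,\beta)}\int d(x,y)\,\gamma(dx,dy)$. The adapted Wasserstein distance between Borel probability measures $\pi,\tilde\pi$ on $\mathcal{X}^2$ with first marginals $\pi_1,\tilde\pi_1$ is $$\mathcal{AW}(\pi,\tilde\pi)=\inf_{\gamma\in\Pi(\pi_1,\tilde\pi_1)}\int\big[d(x_1,y_1)+\mathcal{W}(\pi_{x_1},\tilde\pi_{y_1})\big]\,\gamma(dx_1,dy_1).$$ The Wasserstein correlation coefficient of $\pi\in\Pi(\mu,\nu)$ is $\overrightarrow{\mathcal{W}}(\pi)=\int\mathcal{W}(\pi_{x_1},\nu)\,\mu(dx_1)\big/\int\int d(y,z)\,\nu(dy)\nu(dz)$. *)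

theory Defs
  imports "HOL-Probability.Probability"
begin

definition couplings :: "'a::metric_space measure \<Rightarrow> 'a measure \<Rightarrow> ('a \<times> 'a) measure set" where
  "couplings \<alpha> \<beta> = {\<gamma>. prob_space \<gamma> \<and> sets \<gamma> = sets (borel :: ('a \<times> 'a) measure) \<and>
      distr \<gamma> borel fst = \<alpha> \<and> distr \<gamma> borel snd = \<beta>}"

definition W :: "'a::metric_space measure \<Rightarrow> 'a measure \<Rightarrow> ennreal" where
  "W \<alpha> \<beta> = (INF \<gamma> \<in> couplings \<alpha> \<beta>. \<integral>\<^sup>+ p. ennreal (dist (fst p) (snd p)) \<partial>\<gamma>)"

definition finite_first_moment :: "'a::metric_space measure \<Rightarrow> bool" where
  "finite_first_moment M \<longleftrightarrow> (\<exists>x0. (\<integral>\<^sup>+ x. ennreal (dist x x0) \<partial>M) < \<infinity>)"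

definition is_disintegration ::
  "('a::topological_space \<times> 'a) measure \<Rightarrow> 'a measure \<Rightarrow> ('a \<Rightarrow> 'a measure) \<Rightarrow> bool" where
  "is_disintegration \<pi> \<mu> \<kappa> \<longleftrightarrow>
     (\<forall>x. prob_space (\<kappa> x) \<and> sets (\<kappa> x) = sets (borel :: 'a measure)) \<and>
     (\<forall>B \<in> sets (borel :: 'a measure). (\<lambda>x. emeasure (\<kappa> x) B) \<in> borel_measurable borel) \<and>
     (\<forall>A \<in> sets (borel :: 'a measure). \<forall>B \<in> sets (borel :: 'a measure).
        emeasure \<pi> (A \<times> B) = (\<integral>\<^sup>+ x. indicator A x * emeasure (\<kappa> x) B \<partial>\<mu>))"

text \<open>Adapted Wasserstein distance between \<open>\<pi>\<close> (first marginal \<open>\<mu>\<close>, disintegration \<open>\<kappa>\<close>)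
  and \<open>\<pi>'\<close> (first marginal \<open>\<mu>'\<close>, disintegration \<open>\<kappa>'\<close>).\<close>
definition AW :: "'a::metric_space measure \<Rightarrow> ('a \<Rightarrow> 'a measure) \<Rightarrow> 'a measure \<Rightarrow> ('a \<Rightarrow> 'a measure) \<Rightarrow> ennreal" where
  "AW \<mu> \<kappa> \<mu>' \<kappa>' = (INF \<gamma> \<in> couplings \<mu> \<mu>'.
      \<integral>\<^sup>+ p. (ennreal (dist (fst p) (snd p)) + W (\<kappa> (fst p)) (\<kappa>' (snd p))) \<partial>\<gamma>)"

definition mean_dist :: "'a::metric_space measure \<Rightarrow> real" where
  "mean_dist \<nu> = enn2real (\<integral>\<^sup>+ y. \<integral>\<^sup>+ z. ennreal (dist y z) \<partial>\<nu> \<partial>\<nu>)"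

definition avg_W :: "'a::metric_space measure \<Rightarrow> ('a \<Rightarrow> 'a measure) \<Rightarrow> 'a measure \<Rightarrow> real" where
  "avg_W \<mu> \<kappa> \<nu> = enn2real (\<integral>\<^sup>+ x. W (\<kappa> x) \<nu> \<partial>\<mu>)"

definition Wcorr :: "'a::metric_space measure \<Rightarrow> ('a \<Rightarrow> 'a measure) \<Rightarrow> 'a measure \<Rightarrow> real" where
  "Wcorr \<mu> \<kappa> \<nu> = avg_W \<mu> \<kappa> \<nu> / mean_dist \<nu>"

end

theory Submission
  imports Defs
begin

text \<open>
  Pointwise, the triangle inequality gives \<open>W(\<pi>\<^sub>x, \<nu>) \<le> W(\<pi>\<^sub>x, \<pi>'\<^sub>y) + W(\<pi>'\<^sub>y, \<nu>') + W(\<nu>', \<nu>)\<close>; integrating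
  against a coupling of the first marginals yields the first estimate, and \<open>W(\<nu>, \<nu>') \<le> AW\<close> holds because
  mixing near-optimal couplings of \<open>\<pi>\<^sub>x\<close> and \<open>\<pi>'\<^sub>y\<close> produces a coupling of \<open>\<nu>\<close> and \<open>\<nu>'\<close>. The correlation
  estimate then follows from \<open>\<integral> W(\<pi>\<^sub>x, \<nu>) d\<mu> \<le> f(\<nu>)\<close> and \<open>g(\<nu>, \<nu>') \<le> 2 W(\<nu>, \<nu>')\<close>.

  Both the triangle inequality and the measurable choice of near-optimal couplings are obtained from a
  partition of the space into countably many small Borel cells: up to an arbitrarily small error, a coupling
  may be replaced by one with a density with respect to the product of its marginals that depends on the
  cells only, and countably many such densities suffice.
\<close>

section \<open>Couplings and the triangle inequality\<close>

text \<open>A measurable choice must serve uncountably many pairs (\<open>\<kappa> x\<close>,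
  \<open>\<kappa>' y\<close>) with countably many candidates, whereas a weight matrix adapted to one
  pair has the wrong marginals for another. Candidates are therefore only asked to stay below the
  marginals: a matrix of weights on cells is completed by an independent remainder. Matrices rounded
  down to a finite rational grid can be listed, and rounding down keeps an admissible matrix
  admissible. The remainder is cheap because its mass tends to 0 while the first moments dominate
  its cost. The moments also make all quantities finite, so that passing from \<open>ennreal\<close>
  to \<open>real\<close> loses nothing.

  For the correlation, write A, F for numerator and denominator of the first coefficient and A', F'
  for the second. Then A/F - A'/F' = ((A - A') + (A/F)(F' - F))/F', and A \<le> F leaves F' as the
  only denominator. The constant 3 is 1 + 2, where 2 counts the two points of a pair moved from
  \<nu> to \<nu>'; the constant 4 is 1 + 3, from \<open>W\<close> \<le> \<open>AW\<close>.\<close>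

definition cost :: "('a::metric_space \<times> 'a) measure \<Rightarrow> ennreal" where
  "cost \<gamma> = (\<integral>\<^sup>+ p. ennreal (dist (fst p) (snd p)) \<partial>\<gamma>)"

lemma W_eq_INF_cost: "W \<alpha> \<beta> = (INF \<gamma> \<in> couplings \<alpha> \<beta>. cost \<gamma>)"
  by (simp add: W_def cost_def)

lemma W_less_imp_coupling:
  assumes "W \<alpha> \<beta> < c"
  obtains \<gamma> where "\<gamma> \<in> couplings \<alpha> \<beta>" "cost \<gamma> < c"
proof -
  have "\<exists>\<gamma>\<in>couplings \<alpha> \<beta>. cost \<gamma> < c" using assms unfolding W_eq_INF_cost INF_less_iff .
  then show thesis using that by blast
qed

lemma measurable_dist_ennreal [measurable]:
  "(\<lambda>p::'a::{metric_space,second_countable_topology} \<times> 'a. ennreal (dist (fst p) (snd p)))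
     \<in> borel_measurable (borel \<Otimes>\<^sub>M borel)"
  by measurable

lemma ennreal_less_add_pos:
  assumes "x < top" "0 < (e::real)"
  shows "x < x + ennreal e"
  using assms by (cases x) (auto simp: ennreal_less_iff simp flip: ennreal_plus)

lemma couplingsD:
  fixes \<gamma> :: "('a::{metric_space,second_countable_topology} \<times> 'a) measure"
  assumes "\<gamma> \<in> couplings \<alpha> \<beta>"
  shows "prob_space \<gamma>" "sets \<gamma> = sets (borel \<Otimes>\<^sub>M borel)" "distr \<gamma> borel fst = \<alpha>" "distr \<gamma> borel snd = \<beta>"
  using assms unfolding couplings_def mem_Collect_eq borel_prod by blast+

lemma couplings_marginals:
  fixes \<gamma> :: "('a::{metric_space,second_countable_topology} \<times> 'a) measure"
  assumes "\<gamma> \<in> couplings \<alpha> \<beta>" "f \<in> borel_measurable borel"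
  shows "(\<integral>\<^sup>+ p. f (fst p) \<partial>\<gamma>) = (\<integral>\<^sup>+ x. f x \<partial>\<alpha>)" "(\<integral>\<^sup>+ p. f (snd p) \<partial>\<gamma>) = (\<integral>\<^sup>+ x. f x \<partial>\<beta>)"
proof -
  note [measurable_cong] = couplingsD(2)[OF assms(1)]
  note [measurable] = assms(2)
  show "(\<integral>\<^sup>+ p. f (fst p) \<partial>\<gamma>) = (\<integral>\<^sup>+ x. f x \<partial>\<alpha>)"
    unfolding couplingsD(3)[OF assms(1), symmetric] by (subst nn_integral_distr) auto
  show "(\<integral>\<^sup>+ p. f (snd p) \<partial>\<gamma>) = (\<integral>\<^sup>+ x. f x \<partial>\<beta>)"
    unfolding couplingsD(4)[OF assms(1), symmetric] by (subst nn_integral_distr) auto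
qed

text \<open>\<open>J\<close> sends a point to the first member of a countable dense sequence within
  \<open>e/2\<close>, so two points of a fibre share a centre. Encoding the partition as a map into
  a discrete countable space makes every function of the cell measurable.\<close>

lemma small_cells:
  assumes "e > (0::real)"
  obtains J :: "'a::{metric_space,second_countable_topology} \<Rightarrow> nat" where
    "J \<in> borel \<rightarrow>\<^sub>M count_space UNIV" "\<And>x y. J x = J y \<Longrightarrow> dist x y < e"
proof -
  obtain D :: "'a set" where D: "countable D" "\<And>X. open X \<Longrightarrow> X \<noteq> {} \<Longrightarrow> \<exists>d\<in>D. d \<in> X"
    using countable_dense_setE by blast
  define s where "s = from_nat_into D"
  have ex: "\<exists>n. dist x (s n) < e/2" for x
  proof -
    have "ball x (e/2) \<noteq> {}" using assms by simp
    then obtain d where "d \<in> D" "d \<in> ball x (e/2)" using D(2)[OF open_ball] by blast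
    then show ?thesis using from_nat_into_surj[OF D(1)] unfolding s_def by (metis mem_ball)
  qed
  define J where "J x = (LEAST n. dist x (s n) < e/2)" for x
  have d: "dist x (s (J x)) < e/2" for x unfolding J_def by (rule LeastI_ex[OF ex])
  show thesis
  proof (rule that[of J])
    show "J \<in> borel \<rightarrow>\<^sub>M count_space UNIV" unfolding J_def by measurable
    fix x y assume "J x = J y"
    then show "dist x y < e" using d[of x] d[of y] dist_triangle2[of x y "s (J x)"] by simp
  qed
qed

text \<open>By Tonelli, a function of one coordinate can be pulled out of the integral over the
  other, leaving a row or column integral of \<open>h\<close>. These are required to be 1 only
  almost everywhere, because the normalised densities built later can miss this value on null cells.
  The two spaces are arbitrary since the gluing in \<open>W_triangle\<close> takes couplings, hence
  measures on pairs, as factors.\<close>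

lemma
  fixes M :: "'b measure" and N :: "'c measure" and h :: "'b \<Rightarrow> 'c \<Rightarrow> ennreal"
  assumes "prob_space M" "prob_space N"
  assumes h [measurable]: "(\<lambda>p. h (fst p) (snd p)) \<in> borel_measurable (M \<Otimes>\<^sub>M N)"
    and row: "AE x in M. (\<integral>\<^sup>+ y. h x y \<partial>N) = 1"
    and col: "AE y in N. (\<integral>\<^sup>+ x. h x y \<partial>M) = 1"
  defines "\<Theta> \<equiv> density (M \<Otimes>\<^sub>M N) (\<lambda>p. h (fst p) (snd p))"
  shows nn_integral_density_fst: "f \<in> borel_measurable M \<Longrightarrow> (\<integral>\<^sup>+ p. f (fst p) \<partial>\<Theta>) = (\<integral>\<^sup>+ x. f x \<partial>M)"
    and nn_integral_density_snd: "g \<in> borel_measurable N \<Longrightarrow> (\<integral>\<^sup>+ p. g (snd p) \<partial>\<Theta>) = (\<integral>\<^sup>+ y. g y \<partial>N)"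
    and prob_space_density_pair: "prob_space \<Theta>"
    and distr_density_fst: "distr \<Theta> M fst = M"
    and distr_density_snd: "distr \<Theta> N snd = N"
proof -
  interpret M: prob_space M by fact
  interpret N: prob_space N by fact
  interpret P: pair_prob_space M N ..
  have s [measurable_cong]: "sets \<Theta> = sets (M \<Otimes>\<^sub>M N)" by (simp add: \<Theta>_def)
  have 1: "(\<integral>\<^sup>+ p. f (fst p) \<partial>\<Theta>) = (\<integral>\<^sup>+ x. f x \<partial>M)" if [measurable]: "f \<in> borel_measurable M" for f
  proof -
    have "(\<integral>\<^sup>+ p. f (fst p) \<partial>\<Theta>) = (\<integral>\<^sup>+ p. h (fst p) (snd p) * f (fst p) \<partial>(M \<Otimes>\<^sub>M N))"
      unfolding \<Theta>_def by (rule nn_integral_density) measurable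
    also have "\<dots> = (\<integral>\<^sup>+ x. \<integral>\<^sup>+ y. h x y * f x \<partial>N \<partial>M)"
      by (subst N.nn_integral_fst[symmetric]) auto
    also have "\<dots> = (\<integral>\<^sup>+ x. (\<integral>\<^sup>+ y. h x y \<partial>N) * f x \<partial>M)"
      by (intro nn_integral_cong nn_integral_multc) (use measurable_Pair2[OF h] in simp)
    also have "\<dots> = (\<integral>\<^sup>+ x. f x \<partial>M)"
      by (rule nn_integral_cong_AE) (use row in auto)
    finally show ?thesis .
  qed
  have 2: "(\<integral>\<^sup>+ p. f (snd p) \<partial>\<Theta>) = (\<integral>\<^sup>+ x. f x \<partial>N)" if [measurable]: "f \<in> borel_measurable N" for f
  proof -
    have "(\<integral>\<^sup>+ p. f (snd p) \<partial>\<Theta>) = (\<integral>\<^sup>+ p. h (fst p) (snd p) * f (snd p) \<partial>(M \<Otimes>\<^sub>M N))"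
      unfolding \<Theta>_def by (rule nn_integral_density) measurable
    also have "\<dots> = (\<integral>\<^sup>+ y. \<integral>\<^sup>+ x. h x y * f y \<partial>M \<partial>N)"
      by (subst P.nn_integral_snd[symmetric]) (auto simp: split_beta')
    also have "\<dots> = (\<integral>\<^sup>+ y. (\<integral>\<^sup>+ x. h x y \<partial>M) * f y \<partial>N)"
      by (intro nn_integral_cong nn_integral_multc) (use measurable_Pair1[OF h] in simp)
    also have "\<dots> = (\<integral>\<^sup>+ x. f x \<partial>N)"
      by (rule nn_integral_cong_AE) (use col in auto)
    finally show ?thesis .
  qed
  show "f \<in> borel_measurable M \<Longrightarrow> (\<integral>\<^sup>+ p. f (fst p) \<partial>\<Theta>) = (\<integral>\<^sup>+ x. f x \<partial>M)"
    "g \<in> borel_measurable N \<Longrightarrow> (\<integral>\<^sup>+ p. g (snd p) \<partial>\<Theta>) = (\<integral>\<^sup>+ y. g y \<partial>N)"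
    by (fact 1 2)+
  show "prob_space \<Theta>"
    by rule (use 1[of "\<lambda>_. 1"] M.emeasure_space_1 in simp)
  have [measurable]: "fst \<in> \<Theta> \<rightarrow>\<^sub>M M" "snd \<in> \<Theta> \<rightarrow>\<^sub>M N" by measurable
  show "distr \<Theta> M fst = M"
  proof (rule measure_eqI)
    fix A assume "A \<in> sets (distr \<Theta> M fst)"
    then have [measurable]: "A \<in> sets M" by simp
    have "emeasure (distr \<Theta> M fst) A = (\<integral>\<^sup>+ x. indicator A x \<partial>distr \<Theta> M fst)" by simp
    also have "\<dots> = (\<integral>\<^sup>+ x. indicator A x \<partial>M)"
      by (subst nn_integral_distr) (use 1[of "indicator A"] in auto)
    finally show "emeasure (distr \<Theta> M fst) A = emeasure M A" by simp
  qed simp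
  show "distr \<Theta> N snd = N"
  proof (rule measure_eqI)
    fix A assume "A \<in> sets (distr \<Theta> N snd)"
    then have [measurable]: "A \<in> sets N" by simp
    have "emeasure (distr \<Theta> N snd) A = (\<integral>\<^sup>+ x. indicator A x \<partial>distr \<Theta> N snd)" by simp
    also have "\<dots> = (\<integral>\<^sup>+ x. indicator A x \<partial>N)"
      by (subst nn_integral_distr) (use 2[of "indicator A"] in auto)
    finally show "emeasure (distr \<Theta> N snd) A = emeasure N A" by simp
  qed simp
qed

lemma density_couplings:
  fixes \<alpha> \<beta> :: "'a::{metric_space,second_countable_topology} measure" and h :: "'a \<Rightarrow> 'a \<Rightarrow> ennreal"
  assumes "prob_space \<alpha>" "prob_space \<beta>" "sets \<alpha> = sets borel" "sets \<beta> = sets borel"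
  assumes h: "(\<lambda>p. h (fst p) (snd p)) \<in> borel_measurable (borel \<Otimes>\<^sub>M borel)"
    and "AE x in \<alpha>. (\<integral>\<^sup>+ y. h x y \<partial>\<beta>) = 1" "AE y in \<beta>. (\<integral>\<^sup>+ x. h x y \<partial>\<alpha>) = 1"
  shows "density (\<alpha> \<Otimes>\<^sub>M \<beta>) (\<lambda>p. h (fst p) (snd p)) \<in> couplings \<alpha> \<beta>"
proof -
  have h': "(\<lambda>p. h (fst p) (snd p)) \<in> borel_measurable (\<alpha> \<Otimes>\<^sub>M \<beta>)"
    using h assms(3,4) by (simp cong: measurable_cong_sets sets_pair_measure_cong)
  note * = assms(1,2) h' assms(6,7)
  have "distr \<Theta> borel fst = distr \<Theta> \<alpha> fst" "distr \<Theta> borel snd = distr \<Theta> \<beta> snd" for \<Theta> :: "('a \<times> 'a) measure"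
    using assms(3,4) by (auto intro!: distr_cong)
  then show ?thesis
    using prob_space_density_pair[OF *] distr_density_fst[OF *] distr_density_snd[OF *] assms(3,4)
    by (simp add: couplings_def flip: borel_prod cong: sets_pair_measure_cong)
qed

lemma couplings_swap:
  fixes \<gamma> :: "('a::{metric_space,second_countable_topology} \<times> 'a) measure"
  assumes "\<gamma> \<in> couplings \<alpha> \<beta>"
  shows "\<exists>\<gamma>'\<in>couplings \<beta> \<alpha>. cost \<gamma>' = cost \<gamma>"
proof -
  note [measurable_cong] = couplingsD(2)[OF assms]
  interpret prob_space \<gamma> using couplingsD[OF assms] by simp
  let ?g = "distr \<gamma> (borel \<Otimes>\<^sub>M borel) prod.swap"
  have [measurable]: "prod.swap \<in> \<gamma> \<rightarrow>\<^sub>M borel \<Otimes>\<^sub>M borel"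
    by (rule measurable_cong[THEN iffD1, of _ "\<lambda>p. (snd p, fst p)"]) (auto simp: prod.swap_def split_beta)
  have "?g \<in> couplings \<beta> \<alpha>"
    using couplingsD(3,4)[OF assms]
    by (auto simp: couplings_def distr_distr comp_def simp flip: borel_prod intro!: prob_space_distr)
  moreover have "cost ?g = cost \<gamma>"
    unfolding cost_def by (subst nn_integral_distr) (auto simp: dist_commute)
  ultimately show ?thesis by blast
qed

lemma W_commute:
  fixes \<alpha> \<beta> :: "'a::{metric_space,second_countable_topology} measure"
  shows "W \<alpha> \<beta> = W \<beta> \<alpha>"
proof -
  have "W \<alpha> \<beta> \<le> W \<beta> \<alpha>" for \<alpha> \<beta> :: "'a measure"
    unfolding W_eq_INF_cost by (rule INF_mono) (metis couplings_swap order_refl)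
  then show ?thesis by (simp add: antisym)
qed

text \<open>There are only countably many cells, so the null ones together form a null set. This is
  what makes dividing by the mass of a cell harmless.\<close>

lemma AE_cell_nonnull:
  assumes [measurable]: "J \<in> M \<rightarrow>\<^sub>M count_space (UNIV :: nat set)"
  shows "AE x in M. emeasure M {y \<in> space M. J y = J x} \<noteq> 0"
proof -
  have "AE x in M. J x = i \<longrightarrow> emeasure M {y \<in> space M. J y = i} \<noteq> 0" for i
  proof (cases "emeasure M {y \<in> space M. J y = i} = 0")
    case True
    then show ?thesis by (intro AE_I[of _ _ "{y \<in> space M. J y = i}"]) auto
  qed auto
  then have "AE x in M. \<forall>i. J x = i \<longrightarrow> emeasure M {y \<in> space M. J y = i} \<noteq> 0"
    by (subst AE_all_countable) auto
  then show ?thesis by eventually_elim auto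
qed

lemma ennreal_self_divide: "x \<noteq> 0 \<Longrightarrow> x \<noteq> top \<Longrightarrow> x / x = (1::ennreal)"
  by (simp add: less_top)

text \<open>Gluing without disintegration: two points of a cell \<open>J = i\<close> are at distance less than \<open>e\<close>, so it
  suffices to couple the middle coordinates \<open>y, y'\<close> of \<open>\<pi>\<close> and \<open>\<rho>\<close> conditionally on lying in the same
  cell, which is the density \<open>1 / \<beta>(J = i)\<close> on \<open>\<pi> \<Otimes> \<rho>\<close>.\<close>

lemma W_triangle:
  fixes \<alpha> \<beta> \<delta> :: "'a::{metric_space,second_countable_topology} measure"
  shows "W \<alpha> \<delta> \<le> W \<alpha> \<beta> + W \<beta> \<delta>"
proof -
  have *: "W \<alpha> \<delta> \<le> cost \<pi> + cost \<rho> + ennreal e"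
    if e: "e > 0" and \<pi>: "\<pi> \<in> couplings \<alpha> \<beta>" and \<rho>: "\<rho> \<in> couplings \<beta> \<delta>" for e \<pi> \<rho>
  proof -
    obtain J :: "'a \<Rightarrow> nat" where J [measurable]: "J \<in> borel \<rightarrow>\<^sub>M count_space UNIV"
      and Jd: "\<And>x y. J x = J y \<Longrightarrow> dist x y < e" using small_cells[OF e] by blast
    note [measurable_cong] = couplingsD(2)[OF \<pi>] couplingsD(2)[OF \<rho>]
    interpret \<pi>: prob_space \<pi> using couplingsD[OF \<pi>] by simp
    interpret \<rho>: prob_space \<rho> using couplingsD[OF \<rho>] by simp
    have \<beta>: "prob_space \<beta>" unfolding couplingsD(4)[OF \<pi>, symmetric] by (rule \<pi>.prob_space_distr) measurable
    then interpret \<beta>: prob_space \<beta> .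
    have [measurable_cong]: "sets \<beta> = sets borel" using couplingsD(4)[OF \<pi>] by auto
    define b where "b i = emeasure \<beta> ({y \<in> space \<beta>. J y = i})" for i
    have b1: "b i \<noteq> \<infinity>" for i by (simp add: b_def)
    define h :: "'a \<times> 'a \<Rightarrow> 'a \<times> 'a \<Rightarrow> ennreal" where
      "h p q = (if J (snd p) = J (fst q) then inverse (b (J (snd p))) else 0)" for p q
    have b_int: "(\<integral>\<^sup>+ y. (if J y = i then c else 0) \<partial>\<beta>) = c * b i" for c i
    proof -
      have "(\<integral>\<^sup>+ y. (if J y = i then c else 0) \<partial>\<beta>) = (\<integral>\<^sup>+ y. c * indicator ({y \<in> space \<beta>. J y = i}) y \<partial>\<beta>)"
        by (rule nn_integral_cong) (auto simp: indicator_def)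
      also have "\<dots> = c * emeasure \<beta> ({y \<in> space \<beta>. J y = i})" by (rule nn_integral_cmult_indicator) measurable
      finally show ?thesis by (simp add: b_def)
    qed
    have AEb: "AE y in \<beta>. b (J y) \<noteq> 0" unfolding b_def by (rule AE_cell_nonnull) measurable
    have inv: "inverse (b i) * b i = 1" if "b i \<noteq> 0" for i
      using ennreal_self_divide[of "b i"] that b1[of i] by (simp add: divide_ennreal_def mult.commute)
    have row: "AE p in \<pi>. (\<integral>\<^sup>+ q. h p q \<partial>\<rho>) = 1"
    proof -
      have "(\<integral>\<^sup>+ q. h p q \<partial>\<rho>) = inverse (b (J (snd p))) * b (J (snd p))" for p
        unfolding h_def using couplings_marginals(1)[OF \<rho>, of "\<lambda>y. if J (snd p) = J y then inverse (b (J (snd p))) else 0"]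
          b_int[of "J (snd p)" "inverse (b (J (snd p)))"] by (simp add: eq_commute)
      moreover have "AE p in \<pi>. b (J (snd p)) \<noteq> 0"
        using AEb unfolding couplingsD(4)[OF \<pi>, symmetric] by (subst (asm) AE_distr_iff) auto
      ultimately show ?thesis using inv by auto
    qed
    have col: "AE q in \<rho>. (\<integral>\<^sup>+ p. h p q \<partial>\<pi>) = 1"
    proof -
      have "(\<integral>\<^sup>+ p. h p q \<partial>\<pi>) = inverse (b (J (fst q))) * b (J (fst q))" for q
      proof -
        have "(\<integral>\<^sup>+ p. h p q \<partial>\<pi>) = (\<integral>\<^sup>+ p. (if J (snd p) = J (fst q) then inverse (b (J (fst q))) else 0) \<partial>\<pi>)"
          unfolding h_def by (rule nn_integral_cong) auto
        then show ?thesis using couplings_marginals(2)[OF \<pi>, of "\<lambda>y. if J y = J (fst q) then inverse (b (J (fst q))) else 0"]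
          b_int[of "J (fst q)" "inverse (b (J (fst q)))"] by simp
      qed
      moreover have "AE q in \<rho>. b (J (fst q)) \<noteq> 0"
        using AEb unfolding couplingsD(3)[OF \<rho>, symmetric] by (subst (asm) AE_distr_iff) auto
      ultimately show ?thesis using inv by auto
    qed
    \<comment> \<open>Freezing the cell of the first middle coordinate leaves, for each of countably
      many indices, a function of the second middle coordinate only.\<close>
    have hm [measurable]: "(\<lambda>z. h (fst z) (snd z)) \<in> borel_measurable (\<pi> \<Otimes>\<^sub>M \<rho>)"
      unfolding h_def
      by (rule measurable_compose_countable[where f = "\<lambda>i z. if i = J (fst (snd z)) then inverse (b i) else 0"
            and g = "\<lambda>z. J (snd (fst z))"]) auto
    define \<Theta> where "\<Theta> = density (\<pi> \<Otimes>\<^sub>M \<rho>) (\<lambda>z. h (fst z) (snd z))"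
    have [measurable_cong]: "sets \<Theta> = sets ((borel \<Otimes>\<^sub>M borel) \<Otimes>\<^sub>M (borel \<Otimes>\<^sub>M borel))"
      unfolding \<Theta>_def using couplingsD(2)[OF \<pi>] couplingsD(2)[OF \<rho>] by (simp cong: sets_pair_measure_cong)
    note * = \<pi>.prob_space_axioms \<rho>.prob_space_axioms hm row col
    interpret \<Theta>: prob_space \<Theta> unfolding \<Theta>_def by (rule prob_space_density_pair[OF *])
    \<comment> \<open>Only the outer coordinates are kept. The two middle coordinates share a cell
      instead of coinciding, which costs the extra \<open>e\<close>.\<close>
    let ?g = "distr \<Theta> (borel \<Otimes>\<^sub>M borel) (\<lambda>z. (fst (fst z), snd (snd z)))"
    have "distr ?g borel fst = distr (distr \<Theta> \<pi> fst) borel fst"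
      by (subst (1 2) distr_distr) (auto simp: comp_def)
    also have "\<dots> = \<alpha>" using distr_density_fst[OF *] couplingsD(3)[OF \<pi>] by (simp add: \<Theta>_def)
    finally have 1: "distr ?g borel fst = \<alpha>" .
    have "distr ?g borel snd = distr (distr \<Theta> \<rho> snd) borel snd"
      by (subst (1 2) distr_distr) (auto simp: comp_def)
    also have "\<dots> = \<delta>" using distr_density_snd[OF *] couplingsD(4)[OF \<rho>] by (simp add: \<Theta>_def)
    finally have 2: "distr ?g borel snd = \<delta>" .
    have "?g \<in> couplings \<alpha> \<delta>"
      using 1 2 by (auto simp: couplings_def simp flip: borel_prod intro!: \<Theta>.prob_space_distr)
    then have "W \<alpha> \<delta> \<le> cost ?g" unfolding W_eq_INF_cost by (rule INF_lower)
    also have "\<dots> = (\<integral>\<^sup>+ z. ennreal (dist (fst (fst z)) (snd (snd z))) \<partial>\<Theta>)"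
      unfolding cost_def by (subst nn_integral_distr) auto
    also have "\<dots> = (\<integral>\<^sup>+ z. h (fst z) (snd z) * ennreal (dist (fst (fst z)) (snd (snd z))) \<partial>(\<pi> \<Otimes>\<^sub>M \<rho>))"
      unfolding \<Theta>_def by (rule nn_integral_density) measurable
    also have "\<dots> \<le> (\<integral>\<^sup>+ z. h (fst z) (snd z) * (ennreal (dist (fst (fst z)) (snd (fst z)))
        + ennreal (dist (fst (snd z)) (snd (snd z))) + ennreal e) \<partial>(\<pi> \<Otimes>\<^sub>M \<rho>))"
    proof (rule nn_integral_mono)
      fix z :: "('a \<times> 'a) \<times> 'a \<times> 'a"
      obtain x y y' w where z: "z = ((x,y),(y',w))" by (metis prod.collapse)
      show "h (fst z) (snd z) * ennreal (dist (fst (fst z)) (snd (snd z))) \<le> h (fst z) (snd z) * (ennreal (dist (fst (fst z)) (snd (fst z)))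
        + ennreal (dist (fst (snd z)) (snd (snd z))) + ennreal e)"
      \<comment> \<open>Where the middle points lie in different cells \<open>h\<close> is 0, so the
        four-point inequality is needed only inside a cell.\<close>
      proof (cases "J y = J y'")
        case True
        have "dist x w \<le> dist x y + dist y' w + e"
          using Jd[OF True] dist_triangle[of x w y] dist_triangle[of y w y'] by linarith
        then show ?thesis using e by (intro mult_left_mono) (auto simp: z simp flip: ennreal_plus intro!: ennreal_leI)
      qed (simp add: h_def z)
    qed
    also have "\<dots> = (\<integral>\<^sup>+ z. ennreal (dist (fst (fst z)) (snd (fst z)))
        + ennreal (dist (fst (snd z)) (snd (snd z))) + ennreal e \<partial>\<Theta>)"
      unfolding \<Theta>_def by (rule nn_integral_density[symmetric]) measurable
    also have "\<dots> = (\<integral>\<^sup>+ z. ennreal (dist (fst (fst z)) (snd (fst z))) \<partial>\<Theta>)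
        + (\<integral>\<^sup>+ z. ennreal (dist (fst (snd z)) (snd (snd z))) \<partial>\<Theta>) + ennreal e"
      by (simp add: nn_integral_add \<Theta>.emeasure_space_1)
    also have "\<dots> = cost \<pi> + cost \<rho> + ennreal e"
      unfolding cost_def \<Theta>_def
      using nn_integral_density_fst[OF *, of "\<lambda>p. ennreal (dist (fst p) (snd p))"]
        nn_integral_density_snd[OF *, of "\<lambda>p. ennreal (dist (fst p) (snd p))"] by simp
    finally show ?thesis .
  qed
  show ?thesis
  proof (rule ennreal_le_epsilon)
    fix e :: real assume fin: "W \<alpha> \<beta> + W \<beta> \<delta> < top" and e: "0 < e"
    then have fin: "W \<alpha> \<beta> < top" "W \<beta> \<delta> < top" by (simp_all add: ennreal_add_less_top)
    \<comment> \<open>One third of \<open>e\<close> for each near-optimal coupling and one third for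
      the cell size.\<close>
    have less: "W \<alpha> \<beta> < W \<alpha> \<beta> + ennreal (e/3)" "W \<beta> \<delta> < W \<beta> \<delta> + ennreal (e/3)"
      using fin e by (auto intro!: ennreal_less_add_pos)
    obtain \<pi> where \<pi>: "\<pi> \<in> couplings \<alpha> \<beta>" "cost \<pi> < W \<alpha> \<beta> + ennreal (e/3)"
      by (rule W_less_imp_coupling[OF less(1)])
    obtain \<rho> where \<rho>: "\<rho> \<in> couplings \<beta> \<delta>" "cost \<rho> < W \<beta> \<delta> + ennreal (e/3)"
      by (rule W_less_imp_coupling[OF less(2)])
    have "W \<alpha> \<delta> \<le> cost \<pi> + cost \<rho> + ennreal (e/3)" by (rule *[OF _ \<pi>(1) \<rho>(1)]) (use e in simp)
    also have "\<dots> \<le> (W \<alpha> \<beta> + ennreal (e/3)) + (W \<beta> \<delta> + ennreal (e/3)) + ennreal (e/3)"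
      by (intro add_mono order_refl less_imp_le \<pi>(2) \<rho>(2))
    also have "\<dots> = W \<alpha> \<beta> + W \<beta> \<delta> + (ennreal (e/3) + ennreal (e/3) + ennreal (e/3))" by (simp add: ac_simps)
    also have "ennreal (e/3) + ennreal (e/3) + ennreal (e/3) = ennreal e"
      using e by (simp flip: ennreal_plus)
    finally show "W \<alpha> \<delta> \<le> W \<alpha> \<beta> + W \<beta> \<delta> + ennreal e" .
  qed
qed

section \<open>Couplings with a cellwise constant density\<close>

lemma measurable_nat_pair_fun:
  assumes [measurable]: "f \<in> M \<rightarrow>\<^sub>M count_space UNIV" "g \<in> M \<rightarrow>\<^sub>M count_space UNIV"
  shows "(\<lambda>x. w (f x :: nat) (g x :: nat) :: ennreal) \<in> borel_measurable M"
  by (rule measurable_compose_countable[where f="\<lambda>i x. w i (g x)" and g=f],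
      rule measurable_compose_countable[where g=g]) auto

text \<open>Column masses are row masses of the transposed matrix with respect to the other
  marginal, whence the recurring \<open>\<lambda>j i. w i j\<close>.\<close>

definition row_mass :: "('a \<Rightarrow> nat) \<Rightarrow> (nat \<Rightarrow> nat \<Rightarrow> ennreal) \<Rightarrow> 'a measure \<Rightarrow> nat \<Rightarrow> ennreal" where
  "row_mass J w \<beta> i = (\<integral>\<^sup>+ b. w i (J b) \<partial>\<beta>)"

definition fits :: "('a \<Rightarrow> nat) \<Rightarrow> (nat \<Rightarrow> nat \<Rightarrow> ennreal) \<Rightarrow> 'a measure \<Rightarrow> 'a measure \<Rightarrow> bool" where
  "fits J w \<alpha> \<beta> \<longleftrightarrow> (\<forall>i. row_mass J w \<beta> i \<le> 1) \<and> (\<forall>j. row_mass J (\<lambda>j i. w i j) \<alpha> j \<le> 1)"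

text \<open>\<open>w\<close> is a sub-density with respect to \<open>\<alpha> \<Otimes> \<beta>\<close>; the mass it leaves uncovered is coupled independently.
  The normalising quotient is harmless when the uncovered mass is \<open>0\<close>: the numerator then vanishes almost
  everywhere and \<open>0 / 0 = 0\<close>. If \<open>w\<close> exceeds the marginals we fall back to the product coupling, so that a
  fixed \<open>w\<close> yields a coupling of every pair of measures.\<close>

definition plan_density ::
  "('a \<Rightarrow> nat) \<Rightarrow> (nat \<Rightarrow> nat \<Rightarrow> ennreal) \<Rightarrow> 'a measure \<Rightarrow> 'a measure \<Rightarrow> 'a \<Rightarrow> 'a \<Rightarrow> ennreal" where
  "plan_density J w \<alpha> \<beta> a b =
     (if fits J w \<alpha> \<beta>
      then w (J a) (J b) + (1 - row_mass J w \<beta> (J a)) * (1 - row_mass J (\<lambda>j i. w i j) \<alpha> (J b))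
             / (\<integral>\<^sup>+ a. 1 - row_mass J w \<beta> (J a) \<partial>\<alpha>)
      else 1)"

definition plan ::
  "('a::topological_space \<Rightarrow> nat) \<Rightarrow> (nat \<Rightarrow> nat \<Rightarrow> ennreal) \<Rightarrow> 'a measure \<Rightarrow> 'a measure \<Rightarrow> ('a \<times> 'a) measure" where
  "plan J w \<alpha> \<beta> = density (\<alpha> \<Otimes>\<^sub>M \<beta>) (\<lambda>p. plan_density J w \<alpha> \<beta> (fst p) (snd p))"

locale plan_data =
  fixes \<alpha> \<beta> :: "'a::{metric_space,second_countable_topology} measure"
    and J :: "'a \<Rightarrow> nat" and w :: "nat \<Rightarrow> nat \<Rightarrow> ennreal"
  assumes prob: "prob_space \<alpha>" "prob_space \<beta>"
    and sets [measurable_cong]: "sets \<alpha> = sets borel" "sets \<beta> = sets borel"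
    and J [measurable]: "J \<in> borel \<rightarrow>\<^sub>M count_space UNIV"
begin

sublocale \<alpha>: prob_space \<alpha> by (rule prob)
sublocale \<beta>: prob_space \<beta> by (rule prob)
sublocale P: pair_prob_space \<alpha> \<beta> ..

abbreviation "u a \<equiv> 1 - row_mass J w \<beta> (J a)"
abbreviation "v b \<equiv> 1 - row_mass J (\<lambda>j i. w i j) \<alpha> (J b)"
abbreviation "r \<equiv> (\<integral>\<^sup>+ a. u a \<partial>\<alpha>)"

lemma measurable_w [measurable]: "(\<lambda>p. w (J (fst p)) (J (snd p))) \<in> borel_measurable (borel \<Otimes>\<^sub>M borel)"
  by (rule measurable_nat_pair_fun) measurable

lemma measurable_u [measurable]: "u \<in> borel_measurable borel"
  by (rule measurable_compose_countable[where f="\<lambda>i a. 1 - row_mass J w \<beta> i" and g=J]) measurable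

lemma measurable_v [measurable]: "v \<in> borel_measurable borel"
  by (rule measurable_compose_countable[where f="\<lambda>i a. 1 - row_mass J (\<lambda>j i. w i j) \<alpha> i" and g=J]) measurable

lemma measurable_plan_density [measurable]:
  "(\<lambda>p. plan_density J w \<alpha> \<beta> (fst p) (snd p)) \<in> borel_measurable (borel \<Otimes>\<^sub>M borel)"
proof (cases "fits J w \<alpha> \<beta>")
  case True
  have [measurable]: "(\<lambda>p::'a \<times> 'a. u (fst p)) \<in> borel_measurable (borel \<Otimes>\<^sub>M borel)"
    "(\<lambda>p::'a \<times> 'a. v (snd p)) \<in> borel_measurable (borel \<Otimes>\<^sub>M borel)"
    by (rule measurable_compose[OF measurable_fst measurable_u], rule measurable_compose[OF measurable_snd measurable_v])
  show ?thesis unfolding plan_density_def by (simp only: True if_True) measurable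
qed (simp add: plan_density_def)

lemma r_le_1: "r \<le> 1"
proof -
  have "r \<le> (\<integral>\<^sup>+ a. 1 \<partial>\<alpha>)" by (rule nn_integral_mono) (simp add: diff_le_self_ennreal)
  then show ?thesis by (simp add: \<alpha>.emeasure_space_1)
qed

lemma r_finite: "r \<noteq> top"
  using r_le_1 by (metis ennreal_one_neq_top top.extremum_uniqueI)

text \<open>Both sides are 1 minus the total mass of the sub-density, by Tonelli. One normalising
  constant thus serves rows and columns. The assumption \<open>fits\<close> keeps the truncated
  subtraction of \<open>ennreal\<close> from cutting anything off.\<close>

lemma r_eq:
  assumes "fits J w \<alpha> \<beta>"
  shows "(\<integral>\<^sup>+ b. v b \<partial>\<beta>) = r"
proof -
  have R [measurable]: "(\<lambda>a. row_mass J w \<beta> (J a)) \<in> borel_measurable borel"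
    by (rule measurable_compose_countable[where f="\<lambda>i a. row_mass J w \<beta> i" and g=J]) measurable
  have C [measurable]: "(\<lambda>a. row_mass J (\<lambda>j i. w i j) \<alpha> (J a)) \<in> borel_measurable borel"
    by (rule measurable_compose_countable[where f="\<lambda>i a. row_mass J (\<lambda>j i. w i j) \<alpha> i" and g=J]) measurable
  have R1: "row_mass J w \<beta> i \<le> 1" and C1: "row_mass J (\<lambda>j i. w i j) \<alpha> i \<le> 1" for i
    using assms by (auto simp: fits_def)
  have "(\<integral>\<^sup>+ a. row_mass J w \<beta> (J a) \<partial>\<alpha>) \<le> (\<integral>\<^sup>+ a. 1 \<partial>\<alpha>)" by (intro nn_integral_mono R1)
  then have Rfin: "(\<integral>\<^sup>+ a. row_mass J w \<beta> (J a) \<partial>\<alpha>) \<noteq> \<infinity>"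
    by (auto simp: \<alpha>.emeasure_space_1 top_unique)
  have "(\<integral>\<^sup>+ a. row_mass J (\<lambda>j i. w i j) \<alpha> (J a) \<partial>\<beta>) \<le> (\<integral>\<^sup>+ a. 1 \<partial>\<beta>)" by (intro nn_integral_mono C1)
  then have Cfin: "(\<integral>\<^sup>+ a. row_mass J (\<lambda>j i. w i j) \<alpha> (J a) \<partial>\<beta>) \<noteq> \<infinity>"
    by (auto simp: \<beta>.emeasure_space_1 top_unique)
  have "r = 1 - (\<integral>\<^sup>+ a. row_mass J w \<beta> (J a) \<partial>\<alpha>)"
    by (subst nn_integral_diff) (use R1 Rfin in \<open>auto simp: \<alpha>.emeasure_space_1\<close>)
  also have "(\<integral>\<^sup>+ a. row_mass J w \<beta> (J a) \<partial>\<alpha>) = (\<integral>\<^sup>+ b. row_mass J (\<lambda>j i. w i j) \<alpha> (J b) \<partial>\<beta>)"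
    unfolding row_mass_def using P.Fubini'[of "\<lambda>a b. w (J a) (J b)"] by (simp add: split_beta')
  also have "1 - \<dots> = (\<integral>\<^sup>+ b. v b \<partial>\<beta>)"
    by (subst nn_integral_diff) (use C1 Cfin in \<open>auto simp: \<beta>.emeasure_space_1\<close>)
  finally show ?thesis by simp
qed

lemma row_marginal:
  "AE a in \<alpha>. (\<integral>\<^sup>+ b. plan_density J w \<alpha> \<beta> a b \<partial>\<beta>) = 1"
proof (cases "fits J w \<alpha> \<beta>")
  case True
  have *: "(\<integral>\<^sup>+ b. plan_density J w \<alpha> \<beta> a b \<partial>\<beta>) = row_mass J w \<beta> (J a) + u a * (r / r)" for a
  proof -
    have [measurable]: "(\<lambda>b. w (J a) (J b)) \<in> borel_measurable borel" by (rule measurable_nat_pair_fun) measurable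
    have "(\<integral>\<^sup>+ b. plan_density J w \<alpha> \<beta> a b \<partial>\<beta>) = (\<integral>\<^sup>+ b. w (J a) (J b) + (u a / r) * v b \<partial>\<beta>)"
      by (rule nn_integral_cong) (simp add: plan_density_def True divide_ennreal_def ac_simps)
    also have "\<dots> = row_mass J w \<beta> (J a) + (u a / r) * (\<integral>\<^sup>+ b. v b \<partial>\<beta>)"
      by (subst nn_integral_add, measurable, subst nn_integral_cmult, measurable) (simp add: row_mass_def)
    finally show ?thesis by (simp add: r_eq[OF True] divide_ennreal_def ac_simps)
  qed
  have "row_mass J w \<beta> (J a) \<le> 1" for a using True by (auto simp: fits_def)
  then have **: "row_mass J w \<beta> (J a) + u a = 1" for a by (metis add.commute diff_add_cancel_ennreal)
  show ?thesis
  proof (cases "r = 0")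
    case True
    then have "AE a in \<alpha>. u a = 0" by (subst (asm) nn_integral_0_iff_AE) auto
    then show ?thesis
    proof eventually_elim
      case (elim a)
      then show ?case using **[of a] unfolding * by simp
    qed
  next
    case False
    then show ?thesis unfolding * using ** ennreal_self_divide[OF False r_finite] by simp
  qed
qed (simp add: plan_density_def \<beta>.emeasure_space_1)

lemma col_marginal:
  "AE b in \<beta>. (\<integral>\<^sup>+ a. plan_density J w \<alpha> \<beta> a b \<partial>\<alpha>) = 1"
proof (cases "fits J w \<alpha> \<beta>")
  case True
  have *: "(\<integral>\<^sup>+ a. plan_density J w \<alpha> \<beta> a b \<partial>\<alpha>) = row_mass J (\<lambda>j i. w i j) \<alpha> (J b) + v b * (r / r)" for b
  proof -
    have [measurable]: "(\<lambda>a. w (J a) (J b)) \<in> borel_measurable borel" by (rule measurable_nat_pair_fun) measurable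
    have "(\<integral>\<^sup>+ a. plan_density J w \<alpha> \<beta> a b \<partial>\<alpha>) = (\<integral>\<^sup>+ a. w (J a) (J b) + (v b / r) * u a \<partial>\<alpha>)"
      by (rule nn_integral_cong) (simp add: plan_density_def True divide_ennreal_def ac_simps)
    also have "\<dots> = row_mass J (\<lambda>j i. w i j) \<alpha> (J b) + (v b / r) * r"
      by (subst nn_integral_add, measurable, subst nn_integral_cmult, measurable) (simp add: row_mass_def)
    finally show ?thesis by (simp add: divide_ennreal_def ac_simps)
  qed
  have "row_mass J (\<lambda>j i. w i j) \<alpha> (J b) \<le> 1" for b using True by (auto simp: fits_def)
  then have **: "row_mass J (\<lambda>j i. w i j) \<alpha> (J b) + v b = 1" for b by (metis add.commute diff_add_cancel_ennreal)
  show ?thesis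
  proof (cases "r = 0")
    case r0: True
    then have "(\<integral>\<^sup>+ b. v b \<partial>\<beta>) = 0" using r_eq[OF True] by simp
    then have "AE b in \<beta>. v b = 0" by (subst (asm) nn_integral_0_iff_AE) auto
    then show ?thesis
    proof eventually_elim
      case (elim b)
      then show ?case using **[of b] unfolding * by simp
    qed
  next
    case False
    then show ?thesis unfolding * using ** ennreal_self_divide[OF False r_finite] by simp
  qed
qed (simp add: plan_density_def \<alpha>.emeasure_space_1)

lemma plan_coupling: "plan J w \<alpha> \<beta> \<in> couplings \<alpha> \<beta>"
  unfolding plan_def
  by (rule density_couplings[OF prob sets measurable_plan_density row_marginal col_marginal])

lemma cost_plan_eq:
  "cost (plan J w \<alpha> \<beta>) = (\<integral>\<^sup>+ a. \<integral>\<^sup>+ b. plan_density J w \<alpha> \<beta> a b * ennreal (dist a b) \<partial>\<beta> \<partial>\<alpha>)"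
proof -
  have "cost (plan J w \<alpha> \<beta>) =
      (\<integral>\<^sup>+ p. plan_density J w \<alpha> \<beta> (fst p) (snd p) * ennreal (dist (fst p) (snd p)) \<partial>(\<alpha> \<Otimes>\<^sub>M \<beta>))"
    unfolding cost_def plan_def by (rule nn_integral_density) measurable
  also have "\<dots> = (\<integral>\<^sup>+ a. \<integral>\<^sup>+ b. plan_density J w \<alpha> \<beta> a b * ennreal (dist a b) \<partial>\<beta> \<partial>\<alpha>)"
    by (subst \<beta>.nn_integral_fst[symmetric]) auto
  finally show ?thesis .
qed

text \<open>The independent remainder is estimated by going through the reference point
  \<open>x0\<close>: each of the two resulting terms depends on one variable apart from the weights,
  and integrating out the other weight cancels the normalisation. What is left are first moments
  weighted by the uncovered mass.\<close>

lemma cost_plan_le: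
  assumes "fits J w \<alpha> \<beta>"
  shows "cost (plan J w \<alpha> \<beta>) \<le> (\<integral>\<^sup>+ a. \<integral>\<^sup>+ b. w (J a) (J b) * ennreal (dist a b) \<partial>\<beta> \<partial>\<alpha>)
    + (\<integral>\<^sup>+ a. ennreal (dist a x0) * u a \<partial>\<alpha>) + (\<integral>\<^sup>+ b. ennreal (dist b x0) * v b \<partial>\<beta>)"
proof -
  \<comment> \<open>An inequality suffices and also covers \<open>r = 0\<close>, where the quotient
    is 0.\<close>
  have rr: "r / r \<le> 1"
  proof (cases "r = 0")
    case False then show ?thesis using ennreal_self_divide[OF False r_finite] by simp
  qed simp
  have [measurable]: "(\<lambda>b. w i (J b)) \<in> borel_measurable borel" for i
    by (rule measurable_nat_pair_fun) measurable
  have inner: "(\<integral>\<^sup>+ b. plan_density J w \<alpha> \<beta> a b * ennreal (dist a b) \<partial>\<beta>) \<le>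
     (\<integral>\<^sup>+ b. w (J a) (J b) * ennreal (dist a b) \<partial>\<beta>) + ennreal (dist a x0) * u a
      + u a * ((\<integral>\<^sup>+ b. ennreal (dist b x0) * v b \<partial>\<beta>) / r)" for a
  proof -
    have "(\<integral>\<^sup>+ b. plan_density J w \<alpha> \<beta> a b * ennreal (dist a b) \<partial>\<beta>) \<le>
      (\<integral>\<^sup>+ b. w (J a) (J b) * ennreal (dist a b) + (ennreal (dist a x0) * u a / r) * v b
        + (u a / r) * (ennreal (dist b x0) * v b) \<partial>\<beta>)"
    proof (rule nn_integral_mono)
      fix b
      have "ennreal (dist a b) \<le> ennreal (dist a x0) + ennreal (dist b x0)"
        by (simp add: dist_triangle2 flip: ennreal_plus)
      then have "(u a * v b / r) * ennreal (dist a b) \<le> (u a * v b / r) * (ennreal (dist a x0) + ennreal (dist b x0))"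
        by (rule mult_left_mono) simp
      then show "plan_density J w \<alpha> \<beta> a b * ennreal (dist a b) \<le> w (J a) (J b) * ennreal (dist a b)
         + (ennreal (dist a x0) * u a / r) * v b + (u a / r) * (ennreal (dist b x0) * v b)"
        by (simp add: plan_density_def assms distrib_left distrib_right divide_ennreal_def ac_simps add_left_mono)
    qed
    also have "\<dots> = (\<integral>\<^sup>+ b. w (J a) (J b) * ennreal (dist a b) \<partial>\<beta>) + (ennreal (dist a x0) * u a / r) * (\<integral>\<^sup>+ b. v b \<partial>\<beta>)
        + (u a / r) * (\<integral>\<^sup>+ b. ennreal (dist b x0) * v b \<partial>\<beta>)"
      by (simp add: nn_integral_add nn_integral_cmult)
    also have "\<dots> = (\<integral>\<^sup>+ b. w (J a) (J b) * ennreal (dist a b) \<partial>\<beta>) + (ennreal (dist a x0) * u a) * (r / r)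
        + u a * ((\<integral>\<^sup>+ b. ennreal (dist b x0) * v b \<partial>\<beta>) / r)"
      by (simp add: r_eq[OF assms] divide_ennreal_def ac_simps)
    also have "\<dots> \<le> (\<integral>\<^sup>+ b. w (J a) (J b) * ennreal (dist a b) \<partial>\<beta>) + (ennreal (dist a x0) * u a) * 1
        + u a * ((\<integral>\<^sup>+ b. ennreal (dist b x0) * v b \<partial>\<beta>) / r)"
      by (intro add_mono mult_left_mono rr order_refl) auto
    finally show ?thesis by simp
  qed
  have "cost (plan J w \<alpha> \<beta>) \<le> (\<integral>\<^sup>+ a. (\<integral>\<^sup>+ b. w (J a) (J b) * ennreal (dist a b) \<partial>\<beta>) + ennreal (dist a x0) * u a
      + u a * ((\<integral>\<^sup>+ b. ennreal (dist b x0) * v b \<partial>\<beta>) / r) \<partial>\<alpha>)"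
    unfolding cost_plan_eq by (intro nn_integral_mono inner)
  also have "\<dots> = (\<integral>\<^sup>+ a. \<integral>\<^sup>+ b. w (J a) (J b) * ennreal (dist a b) \<partial>\<beta> \<partial>\<alpha>) + (\<integral>\<^sup>+ a. ennreal (dist a x0) * u a \<partial>\<alpha>)
      + r * ((\<integral>\<^sup>+ b. ennreal (dist b x0) * v b \<partial>\<beta>) / r)"
  proof -
    have [measurable]: "(\<lambda>a. \<integral>\<^sup>+ b. w (J a) (J b) * ennreal (dist a b) \<partial>\<beta>) \<in> borel_measurable \<alpha>"
      using \<beta>.borel_measurable_nn_integral_fst[of "\<lambda>p. w (J (fst p)) (J (snd p)) * ennreal (dist (fst p) (snd p))" \<alpha>]
      by simp
    show ?thesis by (simp add: nn_integral_add nn_integral_multc)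
  qed
  also have "r * ((\<integral>\<^sup>+ b. ennreal (dist b x0) * v b \<partial>\<beta>) / r) = (r / r) * (\<integral>\<^sup>+ b. ennreal (dist b x0) * v b \<partial>\<beta>)"
    by (simp add: divide_ennreal_def ac_simps)
  also have "\<dots> \<le> 1 * (\<integral>\<^sup>+ b. ennreal (dist b x0) * v b \<partial>\<beta>)"
    by (intro mult_right_mono rr) simp
  finally show ?thesis by (simp add: add_left_mono)
qed

end

section \<open>Discretising a given coupling to finitely many grid weights\<close>

lemma suminf_single: "(\<Sum>i::nat. if i = k then f i else 0) = (f k :: ennreal)"
  by (subst suminf_finite[of "{k}"]) auto

lemma nn_integral_cells:
  assumes [measurable]: "J \<in> M \<rightarrow>\<^sub>M count_space UNIV"
  shows "(\<integral>\<^sup>+ x. f (J x) \<partial>M) = (\<Sum>i::nat. f i * emeasure M {x \<in> space M. J x = i})"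
proof -
  have "(\<integral>\<^sup>+ x. f (J x) \<partial>M) = (\<integral>\<^sup>+ x. (\<Sum>i. f i * indicator {x \<in> space M. J x = i} x) \<partial>M)"
  proof (rule nn_integral_cong)
    fix x assume "x \<in> space M"
    then have "(\<Sum>i. f i * indicator {x \<in> space M. J x = i} x) = (\<Sum>i. if i = J x then f i else 0)"
      by (intro suminf_cong) (auto simp: indicator_def)
    also have "\<dots> = f (J x)" by (rule suminf_single)
    finally show "f (J x) = (\<Sum>i. f i * indicator {x \<in> space M. J x = i} x)" by simp
  qed
  also have "\<dots> = (\<Sum>i. \<integral>\<^sup>+ x. f i * indicator {x \<in> space M. J x = i} x \<partial>M)"
    by (rule nn_integral_suminf) measurable
  also have "\<dots> = (\<Sum>i. f i * emeasure M {x \<in> space M. J x = i})"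
    by (intro suminf_cong nn_integral_cmult_indicator) measurable
  finally show ?thesis .
qed

lemma nn_integral_cells2:
  assumes [measurable]: "J \<in> M \<rightarrow>\<^sub>M count_space UNIV" "L \<in> M \<rightarrow>\<^sub>M count_space UNIV"
  shows "(\<integral>\<^sup>+ x. f (J x) (L x) \<partial>M) = (\<Sum>i::nat. \<Sum>j::nat. f i j * emeasure M {x \<in> space M. J x = i \<and> L x = j})"
proof -
  have [measurable]: "(\<lambda>x. f i (L x)) \<in> borel_measurable M" for i
    by (rule measurable_nat_pair_fun) measurable
  have "(\<integral>\<^sup>+ x. f (J x) (L x) \<partial>M) = (\<integral>\<^sup>+ x. (\<Sum>i. f i (L x) * indicator {x \<in> space M. J x = i} x) \<partial>M)"
  proof (rule nn_integral_cong)
    fix x assume "x \<in> space M"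
    then have "(\<Sum>i. f i (L x) * indicator {x \<in> space M. J x = i} x) = (\<Sum>i. if i = J x then f i (L x) else 0)"
      by (intro suminf_cong) (auto simp: indicator_def)
    also have "\<dots> = f (J x) (L x)" by (rule suminf_single)
    finally show "f (J x) (L x) = (\<Sum>i. f i (L x) * indicator {x \<in> space M. J x = i} x)" by simp
  qed
  also have "\<dots> = (\<Sum>i. \<integral>\<^sup>+ x. f i (L x) * indicator {x \<in> space M. J x = i} x \<partial>M)"
    by (rule nn_integral_suminf) measurable
  also have "\<dots> = (\<Sum>i. \<Sum>j. f i j * emeasure M {x \<in> space M. J x = i \<and> L x = j})"
  proof (rule suminf_cong)
    fix i
    have "(\<integral>\<^sup>+ x. f i (L x) * indicator {x \<in> space M. J x = i} x \<partial>M) =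
       (\<integral>\<^sup>+ x. (\<Sum>j. f i j * indicator {x \<in> space M. J x = i \<and> L x = j} x) \<partial>M)"
    proof (rule nn_integral_cong)
      fix x assume "x \<in> space M"
      then have "(\<Sum>j. f i j * indicator {x \<in> space M. J x = i \<and> L x = j} x)
          = (\<Sum>j. if j = L x then f i j * indicator {x \<in> space M. J x = i} x else 0)"
        by (intro suminf_cong) (auto simp: indicator_def)
      also have "\<dots> = f i (L x) * indicator {x \<in> space M. J x = i} x"
        by (rule suminf_single)
      finally show "f i (L x) * indicator {x \<in> space M. J x = i} x
          = (\<Sum>j. f i j * indicator {x \<in> space M. J x = i \<and> L x = j} x)" by simp
    qed
    also have "\<dots> = (\<Sum>j. \<integral>\<^sup>+ x. f i j * indicator {x \<in> space M. J x = i \<and> L x = j} x \<partial>M)"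
      by (rule nn_integral_suminf) measurable
    also have "\<dots> = (\<Sum>j. f i j * emeasure M {x \<in> space M. J x = i \<and> L x = j})"
      by (intro suminf_cong nn_integral_cmult_indicator) measurable
    finally show "(\<integral>\<^sup>+ x. f i (L x) * indicator {x \<in> space M. J x = i} x \<partial>M) = \<dots>" .
  qed
  finally show ?thesis .
qed

text \<open>If \<open>G\<close> records the masses a coupling gives to pairs of cells, this matrix
  is the density of its cellwise average with respect to the product of the marginals. Integrating
  out the second variable cancels \<open>B j\<close> and leaves the sum of
  \<open>G i j / A i\<close>; on a null row everything is \<open>0 / 0 = 0\<close>. Keeping
  \<open>G\<close>, \<open>A\<close>, \<open>B\<close> abstract lets the columns be handled by
  exchanging them.\<close>

lemma row_mass_normalised:
  fixes G :: "nat \<Rightarrow> nat \<Rightarrow> ennreal"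
  assumes [measurable]: "J \<in> \<beta> \<rightarrow>\<^sub>M count_space UNIV"
    and A: "A i = (\<Sum>j. G i j)" "A i \<noteq> top"
    and B: "\<And>j. B j = emeasure \<beta> {x \<in> space \<beta>. J x = j}" "\<And>j. B j \<noteq> top" "\<And>j. G i j \<le> B j"
  shows "row_mass J (\<lambda>i j. G i j / (A i * B j)) \<beta> i = (if A i = 0 then 0 else 1)"
proof -
  have "G i j / (A i * B j) * B j = G i j / A i" for j
  proof (cases "A i = 0 \<or> B j = 0")
    case True
    have "G i j \<le> A i" unfolding A(1) using sum_le_suminf[of "G i" "{j}"] by simp
    with True B(3)[of j] show ?thesis by (auto simp: top_unique)
  next
    case False
    then have "inverse (B j) * B j = 1"
      using ennreal_self_divide[of "B j"] B(2)[of j] by (simp add: divide_ennreal_def mult.commute)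
    with False show ?thesis using A(2) B(2)[of j]
      by (simp add: divide_ennreal_def ennreal_inverse_mult less_top mult.assoc)
  qed
  then have "row_mass J (\<lambda>i j. G i j / (A i * B j)) \<beta> i = (\<Sum>j. G i j * inverse (A i))"
    unfolding row_mass_def by (subst nn_integral_cells) (auto simp: B(1)[symmetric] divide_ennreal_def)
  also have "\<dots> = A i / A i" by (simp add: A(1) divide_ennreal_def)
  finally show ?thesis using A(2) ennreal_self_divide by auto
qed

text \<open>Entries are rounded to multiples of \<open>1 / N\<close> and cut off outside an
  \<open>N\<close> by \<open>N\<close> square, so that each result is described by finitely many
  natural numbers. Rounding is downwards so that row and column masses cannot exceed those of
  \<open>w\<close> and \<open>fits\<close> is inherited.\<close>

definition grid_floor :: "nat \<Rightarrow> (nat \<Rightarrow> nat \<Rightarrow> ennreal) \<Rightarrow> nat \<Rightarrow> nat \<Rightarrow> ennreal" where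
  "grid_floor N w i j = (if i < N \<and> j < N then ennreal (real (nat \<lfloor>real N * enn2real (w i j)\<rfloor>) / real N) else 0)"

lemma grid_floor_transpose: "(\<lambda>j i. grid_floor N w i j) = grid_floor N (\<lambda>j i. w i j)"
  by (auto simp: grid_floor_def fun_eq_iff)

lemma grid_floor_le: "grid_floor N w i j \<le> w i j"
proof (cases "w i j")
  case (real x)
  have "real (nat \<lfloor>real N * x\<rfloor>) / real N \<le> x" if "N > 0"
    using that real by (simp add: divide_le_eq mult.commute)
  then show ?thesis using real by (auto simp: grid_floor_def intro!: ennreal_leI)
qed simp

lemma grid_floor_tendsto:
  assumes "w i j \<noteq> top"
  shows "(\<lambda>N. grid_floor N w i j) \<longlonglongrightarrow> w i j"
proof -
  obtain x where x: "w i j = ennreal x" "0 \<le> x" using assms by (cases "w i j") auto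
  have "(\<lambda>N. real (nat \<lfloor>real N * x\<rfloor>) / real N) \<longlonglongrightarrow> x"
  proof (rule tendsto_sandwich)
    show "\<forall>\<^sub>F N in sequentially. x - 1 / real N \<le> real (nat \<lfloor>real N * x\<rfloor>) / real N"
      using eventually_gt_at_top[of 0]
    proof eventually_elim
      case (elim N)
      have "real N * x - 1 \<le> real (nat \<lfloor>real N * x\<rfloor>)" using x(2) by (simp add: of_nat_nat)
      then have "(real N * x - 1) / real N \<le> real (nat \<lfloor>real N * x\<rfloor>) / real N" by (rule divide_right_mono) simp
      then show ?case using elim by (simp add: diff_divide_distrib)
    qed
    show "\<forall>\<^sub>F N in sequentially. real (nat \<lfloor>real N * x\<rfloor>) / real N \<le> x"
      using eventually_gt_at_top[of 0]
      by eventually_elim (use x(2) in \<open>simp add: divide_le_eq mult.commute\<close>)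
    have "(\<lambda>N. x - 1 / real N) \<longlonglongrightarrow> x - 0" by (intro tendsto_intros lim_1_over_n)
    then show "(\<lambda>N. x - 1 / real N) \<longlonglongrightarrow> x" by simp
  qed simp
  then have "(\<lambda>N. ennreal (real (nat \<lfloor>real N * x\<rfloor>) / real N)) \<longlonglongrightarrow> w i j"
    unfolding x(1) by (rule tendsto_ennrealI)
  moreover have "\<forall>\<^sub>F N in sequentially. ennreal (real (nat \<lfloor>real N * x\<rfloor>) / real N) = grid_floor N w i j"
    using eventually_gt_at_top[of i] eventually_gt_at_top[of j]
    by eventually_elim (simp add: grid_floor_def x)
  ultimately show ?thesis by (rule Lim_transform_eventually)
qed

text \<open>Dominated convergence is applied twice. Along a row, \<open>w\<close> itself dominates
  its rounded versions and is integrable because its row mass is at most 1, so the rounded row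
  masses converge to 1 in almost every row. Then the first moment dominates the outer integrand,
  which tends to 0.\<close>

lemma remainder_tendsto_0:
  fixes \<alpha> \<beta> :: "'a::{metric_space,second_countable_topology} measure"
  assumes [measurable_cong]: "sets \<alpha> = sets borel" "sets \<beta> = sets borel"
    and J [measurable]: "J \<in> borel \<rightarrow>\<^sub>M count_space UNIV"
    and w: "\<And>i j. w i j \<noteq> top" "\<And>i. row_mass J w \<beta> i \<le> 1" "AE a in \<alpha>. row_mass J w \<beta> (J a) = 1"
    and fin: "(\<integral>\<^sup>+ a. ennreal (dist a x0) \<partial>\<alpha>) < \<infinity>"
  shows "(\<lambda>N. \<integral>\<^sup>+ a. ennreal (dist a x0) * (1 - row_mass J (grid_floor N w) \<beta> (J a)) \<partial>\<alpha>) \<longlonglongrightarrow> 0"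
proof -
  have [measurable]: "(\<lambda>b. w' i (J b) :: ennreal) \<in> borel_measurable borel" for w' i
    by (rule measurable_nat_pair_fun) measurable
  have [measurable]: "(\<lambda>a. row_mass J w' \<beta> (J a)) \<in> borel_measurable borel" for w'
    by (rule measurable_compose_countable[where f="\<lambda>i a. row_mass J w' \<beta> i" and g=J]) measurable
  have R: "(\<lambda>N. row_mass J (grid_floor N w) \<beta> i) \<longlonglongrightarrow> row_mass J w \<beta> i" for i
    unfolding row_mass_def
  proof (rule nn_integral_dominated_convergence[where w="\<lambda>b. w i (J b)"])
    show "(\<integral>\<^sup>+ b. w i (J b) \<partial>\<beta>) < \<infinity>"
      using w(2)[of i] unfolding row_mass_def by (simp add: order_le_less_trans)
  qed (auto simp: grid_floor_le intro!: grid_floor_tendsto w(1))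
  have "(\<lambda>N. \<integral>\<^sup>+ a. ennreal (dist a x0) * (1 - row_mass J (grid_floor N w) \<beta> (J a)) \<partial>\<alpha>) \<longlonglongrightarrow> (\<integral>\<^sup>+ a. 0 \<partial>\<alpha>)"
  proof (rule nn_integral_dominated_convergence[where w="\<lambda>a. ennreal (dist a x0)"])
    show "AE a in \<alpha>. ennreal (dist a x0) * (1 - row_mass J (grid_floor N w) \<beta> (J a)) \<le> ennreal (dist a x0)" for N
      by (intro AE_I2) (metis diff_le_self_ennreal mult.right_neutral mult_left_mono zero_le)
    show "AE a in \<alpha>. (\<lambda>N. ennreal (dist a x0) * (1 - row_mass J (grid_floor N w) \<beta> (J a))) \<longlonglongrightarrow> 0"
      using w(3)
    proof eventually_elim
      case (elim a)
      have "(\<lambda>N. 1 - row_mass J (grid_floor N w) \<beta> (J a)) \<longlonglongrightarrow> 1 - row_mass J w \<beta> (J a)"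
        by (intro tendsto_diff_ennreal tendsto_const R) (simp_all add: elim)
      then have "(\<lambda>N. ennreal (dist a x0) * (1 - row_mass J (grid_floor N w) \<beta> (J a)))
          \<longlonglongrightarrow> ennreal (dist a x0) * (1 - row_mass J w \<beta> (J a))"
        by (intro ennreal_tendsto_cmult) auto
      then show ?case by (simp add: elim)
    qed
  qed (use fin in auto)
  then show ?thesis by simp
qed

text \<open>Averaging \<gamma> over each pair of cells gives a coupling with density
  \<open>w\<close>, whose cost exceeds that of \<gamma> by at most \<open>4 * e\<close>. Rounding
  \<open>w\<close> down to a fine enough grid does not increase the covered part of the cost, and
  the uncovered remainder costs less than a further \<open>e\<close>.\<close>

lemma approx_plan:
  fixes \<alpha> \<beta> :: "'a::{metric_space,second_countable_topology} measure"
  assumes \<gamma>: "\<gamma> \<in> couplings \<alpha> \<beta>"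
    and J [measurable]: "J \<in> borel \<rightarrow>\<^sub>M count_space UNIV" and Jd: "\<And>x y. J x = J y \<Longrightarrow> dist x y < e"
    and fin: "(\<integral>\<^sup>+ a. ennreal (dist a x0) \<partial>\<alpha>) < \<infinity>" "(\<integral>\<^sup>+ a. ennreal (dist a x0) \<partial>\<beta>) < \<infinity>"
    and e: "e > 0"
  shows "\<exists>N w. cost (plan J (grid_floor N w) \<alpha> \<beta>) \<le> cost \<gamma> + ennreal (5 * e)"
proof -
  note [measurable_cong] = couplingsD(2)[OF \<gamma>]
  interpret \<gamma>: prob_space \<gamma> using couplingsD[OF \<gamma>] by simp
  have s: "sets \<alpha> = sets borel" "sets \<beta> = sets borel" using couplingsD(3,4)[OF \<gamma>] by auto
  note [measurable_cong] = s
  have p: "prob_space \<alpha>" "prob_space \<beta>"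
    unfolding couplingsD(3,4)[OF \<gamma>, symmetric] by (rule \<gamma>.prob_space_distr; measurable)+
  interpret \<alpha>: prob_space \<alpha> by (rule p)
  interpret \<beta>: prob_space \<beta> by (rule p)
  interpret P: pair_prob_space \<alpha> \<beta> ..
  define A where "A i = emeasure \<alpha> {x \<in> space \<alpha>. J x = i}" for i
  define B where "B i = emeasure \<beta> {x \<in> space \<beta>. J x = i}" for i
  define G where "G i j = emeasure \<gamma> {p \<in> space \<gamma>. J (fst p) = i \<and> J (snd p) = j}" for i j
  define w where "w i j = G i j / (A i * B j)" for i j
  have Afin: "A i \<noteq> top" and Bfin: "B i \<noteq> top" for i by (simp_all add: A_def B_def)
  have A\<gamma>: "A i = emeasure \<gamma> {p \<in> space \<gamma>. J (fst p) = i}" for i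
    unfolding A_def couplingsD(3)[OF \<gamma>, symmetric] by (subst emeasure_distr) (auto intro!: arg_cong[where f="emeasure \<gamma>"])
  have B\<gamma>: "B i = emeasure \<gamma> {p \<in> space \<gamma>. J (snd p) = i}" for i
    unfolding B_def couplingsD(4)[OF \<gamma>, symmetric] by (subst emeasure_distr) (auto intro!: arg_cong[where f="emeasure \<gamma>"])
  have GA: "G i j \<le> A i" and GB: "G i j \<le> B j" for i j
    unfolding A\<gamma> B\<gamma> G_def by (intro emeasure_mono; auto)+
  have Asum: "A i = (\<Sum>j. G i j)" for i
    unfolding A\<gamma> G_def by (subst suminf_emeasure) (auto simp: disjoint_family_on_def intro!: arg_cong[where f="emeasure \<gamma>"])
  have Bsum: "B j = (\<Sum>i. G i j)" for j
    unfolding B\<gamma> G_def by (subst suminf_emeasure) (auto simp: disjoint_family_on_def intro!: arg_cong[where f="emeasure \<gamma>"])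
  have wAB: "w i j * (A i * B j) = G i j" for i j
  proof (cases "A i * B j = 0")
    case True
    then have "G i j = 0" using GA[of i j] GB[of i j] by auto
    with True show ?thesis by (simp add: w_def)
  next
    case False
    then have "inverse (A i * B j) * (A i * B j) = 1"
      using ennreal_self_divide[of "A i * B j"] Afin[of i] Bfin[of j]
      by (simp add: divide_ennreal_def mult.commute ennreal_mult_eq_top_iff)
    then show ?thesis unfolding w_def by (simp add: divide_ennreal_def mult.assoc)
  qed
  \<comment> \<open>An infinite entry could only come from a zero divisor, but then the numerator is
    0 too and the quotient is 0. Finiteness matters because \<open>enn2real\<close> sends
    \<open>top\<close> to 0, which would spoil the convergence of the rounded weights.\<close>
  have wfin: "w i j \<noteq> top" for i j
  proof
    assume top: "w i j = top"
    have "G i j \<noteq> top" by (simp add: G_def)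
    then have "A i * B j = 0" using wAB[of i j] top by (auto simp: ennreal_top_mult split: if_splits)
    then have "G i j = 0" using GA[of i j] GB[of i j] by auto
    then show False using top by (simp add: w_def)
  qed
  have row: "row_mass J w \<beta> i = (if A i = 0 then 0 else 1)" for i
    using row_mass_normalised[where G=G and A=A and B=B and \<beta>=\<beta> and J=J and i=i]
      Asum Afin Bfin GB by (simp add: w_def[abs_def] B_def)
  have col: "row_mass J (\<lambda>j i. w i j) \<alpha> j = (if B j = 0 then 0 else 1)" for j
    using row_mass_normalised[where G="\<lambda>j i. G i j" and A=B and B=A and \<beta>=\<alpha> and J=J and i=j]
      Bsum Bfin Afin GA by (simp add: w_def[abs_def] A_def mult.commute)
  have rowAE: "AE a in \<alpha>. row_mass J w \<beta> (J a) = 1"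
    using AE_cell_nonnull[of J \<alpha>] by (auto simp: row A_def)
  have colAE: "AE a in \<beta>. row_mass J (\<lambda>j i. w i j) \<alpha> (J a) = 1"
    using AE_cell_nonnull[of J \<beta>] by (auto simp: col B_def)
  have row1: "row_mass J w \<beta> i \<le> 1" and col1: "row_mass J (\<lambda>j i. w i j) \<alpha> i \<le> 1" for i
    by (simp_all add: row col)
  have fits: "fits J (grid_floor N w) \<alpha> \<beta>" for N
  proof -
    have "row_mass J (grid_floor N w') M i \<le> row_mass J w' M i" for w' M i
      unfolding row_mass_def by (intro nn_integral_mono grid_floor_le)
    then show ?thesis unfolding fits_def grid_floor_transpose using row1 col1 by (meson order_trans)
  qed
  have mw [measurable]: "(\<lambda>b. w' i (J b) :: ennreal) \<in> borel_measurable borel" for w' i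
    by (rule measurable_nat_pair_fun) measurable
  \<comment> \<open>The averaged coupling and \<gamma> agree on functions that see only the pair of
    cells. This is why the distance is next replaced by one between cell representatives.\<close>
  have change: "(\<integral>\<^sup>+ a. \<integral>\<^sup>+ b. w (J a) (J b) * f (J a) (J b) \<partial>\<beta> \<partial>\<alpha>) = (\<integral>\<^sup>+ p. f (J (fst p)) (J (snd p)) \<partial>\<gamma>)" for f
  proof -
    have "(\<integral>\<^sup>+ a. \<integral>\<^sup>+ b. w (J a) (J b) * f (J a) (J b) \<partial>\<beta> \<partial>\<alpha>) = (\<integral>\<^sup>+ a. (\<Sum>j. w (J a) j * f (J a) j * B j) \<partial>\<alpha>)"
      by (intro nn_integral_cong, subst nn_integral_cells[where J=J and M=\<beta>]) (auto simp: B_def)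
    also have "\<dots> = (\<Sum>i. (\<Sum>j. w i j * f i j * B j) * A i)"
      by (subst nn_integral_cells[where J=J and M=\<alpha>]) (auto simp: A_def)
    also have "\<dots> = (\<Sum>i. \<Sum>j. w i j * f i j * B j * A i)" by simp
    also have "\<dots> = (\<Sum>i. \<Sum>j. f i j * G i j)"
      unfolding wAB[symmetric] by (simp add: ac_simps)
    also have "\<dots> = (\<integral>\<^sup>+ p. f (J (fst p)) (J (snd p)) \<partial>\<gamma>)"
      by (subst nn_integral_cells2) (auto simp: G_def)
    finally show ?thesis .
  qed
  \<comment> \<open>A representative of cell \<open>i\<close>, arbitrary if the cell is empty; it is
    only used at indices of the form \<open>J x\<close>.\<close>
  define c where "c i = (SOME x. J x = i)" for i
  have c: "dist x (c (J x)) \<le> e" for x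
    using someI[of "\<lambda>y. J y = J x" x] Jd[of x "c (J x)"] unfolding c_def by simp
  have cd1: "dist a b \<le> dist (c (J a)) (c (J b)) + 2 * e" for a b
    using c[of a] c[of b] dist_triangle[of a b "c (J a)"] dist_triangle2[of "c (J a)" b "c (J b)"] by linarith
  have cd2: "dist (c (J a)) (c (J b)) \<le> dist a b + 2 * e" for a b
    using c[of a] c[of b] dist_triangle[of "c (J a)" "c (J b)" a] dist_triangle[of a "c (J b)" b]
    by (simp add: dist_commute)
  \<comment> \<open>Passing to the representatives costs \<open>2 * e\<close>, one \<open>e\<close>
    per coordinate, and returning from them under \<gamma> costs as much again.\<close>
  have main: "(\<integral>\<^sup>+ a. \<integral>\<^sup>+ b. w (J a) (J b) * ennreal (dist a b) \<partial>\<beta> \<partial>\<alpha>) \<le> cost \<gamma> + ennreal (4 * e)"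
  proof -
    have "(\<integral>\<^sup>+ a. \<integral>\<^sup>+ b. w (J a) (J b) * ennreal (dist a b) \<partial>\<beta> \<partial>\<alpha>)
        \<le> (\<integral>\<^sup>+ a. \<integral>\<^sup>+ b. w (J a) (J b) * ennreal (dist (c (J a)) (c (J b)) + 2 * e) \<partial>\<beta> \<partial>\<alpha>)"
      by (intro nn_integral_mono mult_left_mono ennreal_leI cd1) simp
    also have "\<dots> = (\<integral>\<^sup>+ p. ennreal (dist (c (J (fst p))) (c (J (snd p))) + 2 * e) \<partial>\<gamma>)"
      by (rule change)
    also have "\<dots> \<le> (\<integral>\<^sup>+ p. ennreal (dist (fst p) (snd p)) + ennreal (4 * e) \<partial>\<gamma>)"
    proof (rule nn_integral_mono)
      fix p
      show "ennreal (dist (c (J (fst p))) (c (J (snd p))) + 2 * e) \<le> ennreal (dist (fst p) (snd p)) + ennreal (4 * e)"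
        using cd2[of "fst p" "snd p"] e by (simp add: ennreal_leI flip: ennreal_plus)
    qed
    also have "\<dots> = cost \<gamma> + ennreal (4 * e)"
      by (simp add: nn_integral_add cost_def \<gamma>.emeasure_space_1)
    finally show ?thesis .
  qed
  let ?u = "\<lambda>N. \<integral>\<^sup>+ a. ennreal (dist a x0) * (1 - row_mass J (grid_floor N w) \<beta> (J a)) \<partial>\<alpha>"
  let ?v = "\<lambda>N. \<integral>\<^sup>+ b. ennreal (dist b x0) * (1 - row_mass J (grid_floor N (\<lambda>j i. w i j)) \<alpha> (J b)) \<partial>\<beta>"
  have "?u \<longlonglongrightarrow> 0" by (rule remainder_tendsto_0[OF s J wfin row1 rowAE fin(1)])
  moreover have "?v \<longlonglongrightarrow> 0" by (rule remainder_tendsto_0[OF s(2,1) J wfin col1 colAE fin(2)])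
  ultimately have "(\<lambda>N. ?u N + ?v N) \<longlonglongrightarrow> 0 + 0" by (rule tendsto_add)
  then have "\<forall>\<^sub>F N in sequentially. ?u N + ?v N < ennreal e"
    using e by (intro order_tendstoD) auto
  then obtain N where N: "?u N + ?v N < ennreal e" by (auto simp: eventually_sequentially)
  interpret D: plan_data \<alpha> \<beta> J "grid_floor N w"
    by (rule plan_data.intro[OF p s J])
  have "cost (plan J (grid_floor N w) \<alpha> \<beta>) \<le>
      (\<integral>\<^sup>+ a. \<integral>\<^sup>+ b. grid_floor N w (J a) (J b) * ennreal (dist a b) \<partial>\<beta> \<partial>\<alpha>) + ?u N + ?v N"
    using D.cost_plan_le[OF fits, of x0] unfolding grid_floor_transpose .
  also have "\<dots> \<le> (cost \<gamma> + ennreal (4 * e)) + (?u N + ?v N)"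
    unfolding add.assoc[of _ "?u N"]
    by (intro add_mono order_refl order_trans[OF _ main] nn_integral_mono mult_right_mono grid_floor_le) simp
  also have "\<dots> \<le> (cost \<gamma> + ennreal (4 * e)) + ennreal e"
    using N by (intro add_mono) auto
  also have "\<dots> = cost \<gamma> + ennreal (5 * e)"
    using e by (simp add: add.assoc flip: ennreal_plus)
  finally show ?thesis by blast
qed

section \<open>Measurable selection of near-optimal couplings\<close>

lemma measurable_row_mass_kernel:
  assumes [measurable]: "K \<in> M \<rightarrow>\<^sub>M prob_algebra borel" "J \<in> borel \<rightarrow>\<^sub>M count_space UNIV"
  shows "(\<lambda>x. row_mass J w (K x) i) \<in> borel_measurable M"
proof -
  have [measurable]: "K \<in> M \<rightarrow>\<^sub>M subprob_algebra borel" by (rule measurable_prob_algebraD) measurable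
  have [measurable]: "(\<lambda>b. w i (J b)) \<in> borel_measurable borel" by (rule measurable_nat_pair_fun) measurable
  show ?thesis unfolding row_mass_def by measurable
qed

lemma measurable_plan_density_kernel:
  assumes [measurable]: "K\<^sub>1 \<in> M \<rightarrow>\<^sub>M prob_algebra borel" "K\<^sub>2 \<in> M \<rightarrow>\<^sub>M prob_algebra borel"
    "J \<in> borel \<rightarrow>\<^sub>M count_space UNIV"
  shows "(\<lambda>(x, p). plan_density J w (K\<^sub>1 x) (K\<^sub>2 x) (fst p) (snd p)) \<in> borel_measurable (M \<Otimes>\<^sub>M (borel \<Otimes>\<^sub>M borel))"
proof -
  have K [measurable]: "K\<^sub>1 \<in> M \<rightarrow>\<^sub>M subprob_algebra borel" "K\<^sub>2 \<in> M \<rightarrow>\<^sub>M subprob_algebra borel"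
    by (rule measurable_prob_algebraD; measurable)+
  note [measurable] = measurable_row_mass_kernel
  \<comment> \<open>Freezing the cell index reduces joint measurability in parameter and point to
    the measurability of a single row mass in the parameter, for countably many indices.\<close>
  have u: "(\<lambda>z. 1 - row_mass J w (K\<^sub>2 (fst z)) (J (snd z))) \<in> borel_measurable (M \<Otimes>\<^sub>M borel)"
    by (rule measurable_compose_countable[where f="\<lambda>i z. 1 - row_mass J w (K\<^sub>2 (fst z)) i" and g="\<lambda>z. J (snd z)"]) measurable
  have v: "(\<lambda>z. 1 - row_mass J (\<lambda>j i. w i j) (K\<^sub>1 (fst z)) (J (snd z))) \<in> borel_measurable (M \<Otimes>\<^sub>M borel)"
    by (rule measurable_compose_countable[where f="\<lambda>i z. 1 - row_mass J (\<lambda>j i. w i j) (K\<^sub>1 (fst z)) i" and g="\<lambda>z. J (snd z)"]) measurable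
  have r [measurable]: "(\<lambda>x. \<integral>\<^sup>+ a. 1 - row_mass J w (K\<^sub>2 x) (J a) \<partial>K\<^sub>1 x) \<in> borel_measurable M"
    by (rule nn_integral_measurable_subprob_algebra2[OF _ K(1)]) (use u in \<open>simp add: split_beta'\<close>)
  \<comment> \<open>Admissibility is a conjunction of countably many inequalities, so the fallback
    to the product coupling happens on a measurable set of parameters.\<close>
  have [measurable]: "Measurable.pred M (\<lambda>x. fits J w (K\<^sub>1 x) (K\<^sub>2 x))"
    unfolding fits_def by measurable
  have [measurable]: "(\<lambda>z. 1 - row_mass J w (K\<^sub>2 (fst z)) (J (fst (snd z)))) \<in> borel_measurable (M \<Otimes>\<^sub>M (borel \<Otimes>\<^sub>M borel))"
    using measurable_compose[OF _ u, of "\<lambda>z. (fst z, fst (snd z))" "M \<Otimes>\<^sub>M (borel \<Otimes>\<^sub>M borel)"] by simp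
  have [measurable]: "(\<lambda>z. 1 - row_mass J (\<lambda>j i. w i j) (K\<^sub>1 (fst z)) (J (snd (snd z)))) \<in> borel_measurable (M \<Otimes>\<^sub>M (borel \<Otimes>\<^sub>M borel))"
    using measurable_compose[OF _ v, of "\<lambda>z. (fst z, snd (snd z))" "M \<Otimes>\<^sub>M (borel \<Otimes>\<^sub>M borel)"] by simp
  have [measurable]: "(\<lambda>z. w (J (fst (snd z))) (J (snd (snd z)))) \<in> borel_measurable (M \<Otimes>\<^sub>M (borel \<Otimes>\<^sub>M borel))"
    by (rule measurable_nat_pair_fun) measurable
  show ?thesis unfolding plan_density_def split_beta' by measurable
qed

lemma prob_algebraD:
  assumes "K \<in> M \<rightarrow>\<^sub>M prob_algebra N" "x \<in> space M"
  shows "prob_space (K x)" "sets (K x) = sets N"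
  using measurable_space[OF assms] by (simp_all add: space_prob_algebra)

lemma measurable_plan_kernel:
  fixes K\<^sub>1 K\<^sub>2 :: "'b \<Rightarrow> 'a::{metric_space,second_countable_topology} measure"
  assumes K [measurable]: "K\<^sub>1 \<in> M \<rightarrow>\<^sub>M prob_algebra borel" "K\<^sub>2 \<in> M \<rightarrow>\<^sub>M prob_algebra borel"
    and J: "J \<in> borel \<rightarrow>\<^sub>M count_space UNIV"
  shows "(\<lambda>x. plan J w (K\<^sub>1 x) (K\<^sub>2 x)) \<in> M \<rightarrow>\<^sub>M prob_algebra (borel \<Otimes>\<^sub>M borel)"
    and "x \<in> space M \<Longrightarrow> plan J w (K\<^sub>1 x) (K\<^sub>2 x) \<in> couplings (K\<^sub>1 x) (K\<^sub>2 x)"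
proof -
  show c: "plan J w (K\<^sub>1 x) (K\<^sub>2 x) \<in> couplings (K\<^sub>1 x) (K\<^sub>2 x)" if "x \<in> space M" for x
    by (intro plan_data.plan_coupling plan_data.intro prob_algebraD[OF K(1) that] prob_algebraD[OF K(2) that] J)
  note d [measurable] = measurable_plan_density_kernel[OF K J, of w]
  show "(\<lambda>x. plan J w (K\<^sub>1 x) (K\<^sub>2 x)) \<in> M \<rightarrow>\<^sub>M prob_algebra (borel \<Otimes>\<^sub>M borel)"
  proof (intro measurable_prob_algebraI measurable_subprob_algebra)
    fix A :: "('a \<times> 'a) set" assume A [measurable]: "A \<in> sets (borel \<Otimes>\<^sub>M borel)"
    have "(\<lambda>x. \<integral>\<^sup>+ p. plan_density J w (K\<^sub>1 x) (K\<^sub>2 x) (fst p) (snd p) * indicator A p \<partial>(K\<^sub>1 x \<Otimes>\<^sub>M K\<^sub>2 x)) \<in> borel_measurable M"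
      by (rule nn_integral_measurable_subprob_algebra2[where N="borel \<Otimes>\<^sub>M borel"])
         (use d in \<open>auto simp: split_beta' intro!: measurable_prob_algebraD measurable_pair_prob\<close>)
    moreover have "emeasure (plan J w (K\<^sub>1 x) (K\<^sub>2 x)) A =
      (\<integral>\<^sup>+ p. plan_density J w (K\<^sub>1 x) (K\<^sub>2 x) (fst p) (snd p) * indicator A p \<partial>(K\<^sub>1 x \<Otimes>\<^sub>M K\<^sub>2 x))"
      if x: "x \<in> space M" for x
    proof -
      have s: "sets (K\<^sub>1 x \<Otimes>\<^sub>M K\<^sub>2 x) = sets (borel \<Otimes>\<^sub>M borel)"
        using prob_algebraD(2)[OF K(1) x] prob_algebraD(2)[OF K(2) x] by (rule sets_pair_measure_cong)
      interpret D: plan_data "K\<^sub>1 x" "K\<^sub>2 x" J w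
        by (rule plan_data.intro[OF prob_algebraD(1)[OF K(1) x] prob_algebraD(1)[OF K(2) x]
              prob_algebraD(2)[OF K(1) x] prob_algebraD(2)[OF K(2) x] J])
      show ?thesis unfolding plan_def
        by (rule emeasure_density) (use A s D.measurable_plan_density in \<open>simp_all cong: measurable_cong_sets\<close>)
    qed
    ultimately show "(\<lambda>x. emeasure (plan J w (K\<^sub>1 x) (K\<^sub>2 x)) A) \<in> borel_measurable M"
      by (subst measurable_cong) auto
  qed (use couplingsD(1,2)[OF c] in \<open>auto intro: prob_space_imp_subprob_space\<close>)
qed

lemma measurable_cost: "cost \<in> borel_measurable (prob_algebra (borel \<Otimes>\<^sub>M (borel :: 'a::{metric_space,second_countable_topology} measure)))"
proof -
  have "(\<lambda>\<gamma>. \<integral>\<^sup>+ p. ennreal (dist (fst p) (snd p)) \<partial>\<gamma>) \<in> borel_measurable (subprob_algebra (borel \<Otimes>\<^sub>M (borel :: 'a measure)))"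
    by (rule nn_integral_measurable_subprob_algebra) measurable
  then show ?thesis unfolding cost_def[abs_def] prob_algebra_def by (rule measurable_restrict_space1)
qed

text \<open>Association lists of index pairs and numerators form a countable type, which can be
  enumerated by \<open>from_nat\<close>; the matrices \<open>grid_floor N w\<close> are all of this
  form although \<open>w\<close> ranges over an uncountable set.\<close>

definition list_weights :: "nat \<Rightarrow> ((nat \<times> nat) \<times> nat) list \<Rightarrow> nat \<Rightarrow> nat \<Rightarrow> ennreal" where
  "list_weights N l i j = (case map_of l (i, j) of None \<Rightarrow> 0 | Some m \<Rightarrow> ennreal (real m / real N))"

lemma grid_floor_eq_list_weights: "\<exists>l. grid_floor N w = list_weights N l"
proof
  let ?l = "map (\<lambda>p. (p, nat \<lfloor>real N * enn2real (w (fst p) (snd p))\<rfloor>)) (List.product [0..<N] [0..<N])"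
  show "grid_floor N w = list_weights N ?l"
    unfolding map_of_map_restrict list_weights_def grid_floor_def fun_eq_iff
    by (auto simp: map_of_map_restrict restrict_map_def)
qed

text \<open>The plans built from rational weights form a countable family, so choosing the first good one is a
  measurable selection.\<close>

lemma measurable_eps_optimal_coupling:
  fixes K\<^sub>1 K\<^sub>2 :: "'b \<Rightarrow> 'a::{metric_space,second_countable_topology} measure"
  assumes K [measurable]: "K\<^sub>1 \<in> M \<rightarrow>\<^sub>M prob_algebra borel" "K\<^sub>2 \<in> M \<rightarrow>\<^sub>M prob_algebra borel"
    and e: "e > (0::real)"
  obtains \<Gamma> where "\<Gamma> \<in> M \<rightarrow>\<^sub>M prob_algebra (borel \<Otimes>\<^sub>M borel)"
    "\<And>x. x \<in> space M \<Longrightarrow> \<Gamma> x \<in> couplings (K\<^sub>1 x) (K\<^sub>2 x)"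
    "\<And>x x0. x \<in> space M \<Longrightarrow> (\<integral>\<^sup>+ a. ennreal (dist a x0) \<partial>K\<^sub>1 x) < \<infinity> \<Longrightarrow> (\<integral>\<^sup>+ a. ennreal (dist a x0) \<partial>K\<^sub>2 x) < \<infinity>
        \<Longrightarrow> cost (\<Gamma> x) \<le> W (K\<^sub>1 x) (K\<^sub>2 x) + ennreal e"
proof -
  \<comment> \<open>Discretisation loses five times the cell size, here \<open>e / 4\<close>.
    Another \<open>e / 4\<close> goes to a near-optimal coupling and \<open>e / 2\<close> to the
    choice of the index \<open>k\<close>.\<close>
  have "e / 20 > 0" using e by simp
  then obtain J :: "'a \<Rightarrow> nat" where J: "J \<in> borel \<rightarrow>\<^sub>M count_space UNIV"
    and Jd: "\<And>x y. J x = J y \<Longrightarrow> dist x y < e / 20" using small_cells by blast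
  define P where "P k = (case from_nat k of (N, l) \<Rightarrow> plan J (list_weights N l))" for k
  define f where "f k x = cost (P k (K\<^sub>1 x) (K\<^sub>2 x))" for k x
  have Pm: "(\<lambda>x. P k (K\<^sub>1 x) (K\<^sub>2 x)) \<in> M \<rightarrow>\<^sub>M prob_algebra (borel \<Otimes>\<^sub>M borel)" for k
    unfolding P_def by (cases "from_nat k :: nat \<times> ((nat \<times> nat) \<times> nat) list") (use measurable_plan_kernel(1)[OF K J] in simp)
  have Pc: "P k (K\<^sub>1 x) (K\<^sub>2 x) \<in> couplings (K\<^sub>1 x) (K\<^sub>2 x)" if "x \<in> space M" for k x
    unfolding P_def by (cases "from_nat k :: nat \<times> ((nat \<times> nat) \<times> nat) list") (use measurable_plan_kernel(2)[OF K J that] in simp)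
  have f [measurable]: "f k \<in> borel_measurable M" for k
    unfolding f_def by (rule measurable_compose[OF Pm measurable_cost])
  define S where "S x = (INF k. f k x)" for x
  have S [measurable]: "S \<in> borel_measurable M" unfolding S_def[abs_def] by measurable
  \<comment> \<open>If the infimum is \<open>top\<close>, no candidate lies strictly below the
    threshold; the default 0 is then as good as any index, since the bound by \<open>S x\<close> is
    trivial.\<close>
  define k where "k x = (if S x = top then 0 else (LEAST k. f k x < S x + ennreal (e / 2)))" for x
  have [measurable]: "k \<in> M \<rightarrow>\<^sub>M count_space UNIV" unfolding k_def by measurable
  have fk: "f (k x) x \<le> S x + ennreal (e / 2)" for x
  proof (cases "S x = top")
    case False
    then have "S x < S x + ennreal (e / 2)" using e by (intro ennreal_less_add_pos) (auto simp: less_top)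
    then have "\<exists>k. f k x < S x + ennreal (e / 2)" unfolding S_def INF_less_iff by auto
    from LeastI_ex[OF this] show ?thesis using False by (simp add: k_def)
  qed simp
  define \<Gamma> where "\<Gamma> x = P (k x) (K\<^sub>1 x) (K\<^sub>2 x)" for x
  show thesis
  proof (rule that[of \<Gamma>])
    show "\<Gamma> \<in> M \<rightarrow>\<^sub>M prob_algebra (borel \<Otimes>\<^sub>M borel)"
      unfolding \<Gamma>_def[abs_def] by (rule measurable_compose_countable[OF Pm]) measurable
    show "\<Gamma> x \<in> couplings (K\<^sub>1 x) (K\<^sub>2 x)" if "x \<in> space M" for x
      unfolding \<Gamma>_def by (rule Pc[OF that])
    fix x x0 assume x: "x \<in> space M" and fin: "(\<integral>\<^sup>+ a. ennreal (dist a x0) \<partial>K\<^sub>1 x) < \<infinity>" "(\<integral>\<^sup>+ a. ennreal (dist a x0) \<partial>K\<^sub>2 x) < \<infinity>"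
    have Sle: "S x \<le> cost \<gamma> + ennreal (e / 4)" if \<gamma>: "\<gamma> \<in> couplings (K\<^sub>1 x) (K\<^sub>2 x)" for \<gamma>
    proof -
      obtain N w where Nw: "cost (plan J (grid_floor N w) (K\<^sub>1 x) (K\<^sub>2 x)) \<le> cost \<gamma> + ennreal (5 * (e / 20))"
        using approx_plan[OF \<gamma> J Jd fin \<open>e / 20 > 0\<close>] by blast
      obtain l where "grid_floor N w = list_weights N l" using grid_floor_eq_list_weights by blast
      then have "f (to_nat (N, l)) x \<le> cost \<gamma> + ennreal (e / 4)"
        using Nw by (simp add: f_def P_def)
      then show ?thesis unfolding S_def by (rule INF_lower2[OF UNIV_I])
    qed
    have "S x \<le> W (K\<^sub>1 x) (K\<^sub>2 x) + ennreal (e / 2)"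
    proof (cases "W (K\<^sub>1 x) (K\<^sub>2 x) = top")
      case False
      then have "W (K\<^sub>1 x) (K\<^sub>2 x) < W (K\<^sub>1 x) (K\<^sub>2 x) + ennreal (e / 4)" using e by (intro ennreal_less_add_pos) (auto simp: less_top)
      then obtain \<gamma> where \<gamma>: "\<gamma> \<in> couplings (K\<^sub>1 x) (K\<^sub>2 x)" "cost \<gamma> < W (K\<^sub>1 x) (K\<^sub>2 x) + ennreal (e / 4)"
        by (rule W_less_imp_coupling)
      have "S x \<le> (W (K\<^sub>1 x) (K\<^sub>2 x) + ennreal (e / 4)) + ennreal (e / 4)"
        using Sle[OF \<gamma>(1)] \<gamma>(2) by (meson add_right_mono less_imp_le order_trans)
      also have "\<dots> = W (K\<^sub>1 x) (K\<^sub>2 x) + ennreal (e / 2)" using e by (simp add: add.assoc flip: ennreal_plus)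
      finally show ?thesis .
    qed simp
    then have "f (k x) x \<le> (W (K\<^sub>1 x) (K\<^sub>2 x) + ennreal (e / 2)) + ennreal (e / 2)"
      using fk[of x] by (meson add_right_mono order_trans)
    also have "\<dots> = W (K\<^sub>1 x) (K\<^sub>2 x) + ennreal e" using e by (simp add: add.assoc flip: ennreal_plus)
    finally show "cost (\<Gamma> x) \<le> W (K\<^sub>1 x) (K\<^sub>2 x) + ennreal e" by (simp add: f_def \<Gamma>_def)
  qed
qed

text \<open>\<^const>\<open>nn_integral\<close> is additive only on measurable functions; \<open>g\<close> replaces \<^const>\<open>W\<close> under the integral.\<close>

lemma measurable_W_version:
  fixes K\<^sub>1 K\<^sub>2 :: "'b \<Rightarrow> 'a::{metric_space,second_countable_topology} measure"
  assumes K: "K\<^sub>1 \<in> M \<rightarrow>\<^sub>M prob_algebra borel" "K\<^sub>2 \<in> M \<rightarrow>\<^sub>M prob_algebra borel"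
  obtains g where "g \<in> borel_measurable M"
    "\<And>x x0. x \<in> space M \<Longrightarrow> (\<integral>\<^sup>+ a. ennreal (dist a x0) \<partial>K\<^sub>1 x) < \<infinity> \<Longrightarrow> (\<integral>\<^sup>+ a. ennreal (dist a x0) \<partial>K\<^sub>2 x) < \<infinity>
        \<Longrightarrow> g x = W (K\<^sub>1 x) (K\<^sub>2 x)"
proof -
  have "\<exists>\<Gamma>. \<Gamma> \<in> M \<rightarrow>\<^sub>M prob_algebra (borel \<Otimes>\<^sub>M borel) \<and>
    (\<forall>x \<in> space M. \<Gamma> x \<in> couplings (K\<^sub>1 x) (K\<^sub>2 x)) \<and>
    (\<forall>x \<in> space M. \<forall>x0. (\<integral>\<^sup>+ a. ennreal (dist a x0) \<partial>K\<^sub>1 x) < \<infinity> \<longrightarrow> (\<integral>\<^sup>+ a. ennreal (dist a x0) \<partial>K\<^sub>2 x) < \<infinity>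
        \<longrightarrow> cost (\<Gamma> x) \<le> W (K\<^sub>1 x) (K\<^sub>2 x) + ennreal (1 / Suc n))" for n
    by (rule measurable_eps_optimal_coupling[OF K, of "1 / Suc n"]) (simp, blast)
  then obtain \<Gamma> where \<Gamma>: "\<And>n. \<Gamma> n \<in> M \<rightarrow>\<^sub>M prob_algebra (borel \<Otimes>\<^sub>M borel)"
    "\<And>n x. x \<in> space M \<Longrightarrow> \<Gamma> n x \<in> couplings (K\<^sub>1 x) (K\<^sub>2 x)"
    "\<And>n x x0. x \<in> space M \<Longrightarrow> (\<integral>\<^sup>+ a. ennreal (dist a x0) \<partial>K\<^sub>1 x) < \<infinity> \<Longrightarrow> (\<integral>\<^sup>+ a. ennreal (dist a x0) \<partial>K\<^sub>2 x) < \<infinity>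
        \<Longrightarrow> cost (\<Gamma> n x) \<le> W (K\<^sub>1 x) (K\<^sub>2 x) + ennreal (1 / Suc n)"
    by metis
  show thesis
  \<comment> \<open>An infimum over the uncountable set of couplings is not visibly measurable; the
    infimum along a sequence of selections with errors \<open>1 / Suc n\<close> is, and it has the
    same value wherever the moments are finite.\<close>
  proof (rule that[of "\<lambda>x. INF n. cost (\<Gamma> n x)"])
    have [measurable]: "(\<lambda>x. cost (\<Gamma> n x)) \<in> borel_measurable M" for n
      by (rule measurable_compose[OF \<Gamma>(1) measurable_cost])
    show "(\<lambda>x. INF n. cost (\<Gamma> n x)) \<in> borel_measurable M" by measurable
    fix x x0 assume x: "x \<in> space M" and fin: "(\<integral>\<^sup>+ a. ennreal (dist a x0) \<partial>K\<^sub>1 x) < \<infinity>" "(\<integral>\<^sup>+ a. ennreal (dist a x0) \<partial>K\<^sub>2 x) < \<infinity>"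
    show "(INF n. cost (\<Gamma> n x)) = W (K\<^sub>1 x) (K\<^sub>2 x)"
    proof (rule antisym)
      show "W (K\<^sub>1 x) (K\<^sub>2 x) \<le> (INF n. cost (\<Gamma> n x))"
        unfolding W_eq_INF_cost by (intro INF_greatest INF_lower \<Gamma>(2) x)
      show "(INF n. cost (\<Gamma> n x)) \<le> W (K\<^sub>1 x) (K\<^sub>2 x)"
      proof (rule ennreal_le_epsilon)
        fix e :: real assume "0 < e"
        then obtain n where n: "1 / Suc n < e" using nat_approx_posE by blast
        have "(INF n. cost (\<Gamma> n x)) \<le> cost (\<Gamma> n x)" by (rule INF_lower) simp
        also have "\<dots> \<le> W (K\<^sub>1 x) (K\<^sub>2 x) + ennreal (1 / Suc n)" by (rule \<Gamma>(3)[OF x fin])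
        also have "\<dots> \<le> W (K\<^sub>1 x) (K\<^sub>2 x) + ennreal e" using n by (intro add_left_mono ennreal_leI) simp
        finally show "(INF n. cost (\<Gamma> n x)) \<le> W (K\<^sub>1 x) (K\<^sub>2 x) + ennreal e" .
      qed
    qed
  qed
qed

section \<open>Product couplings and mean distances\<close>

lemma product_coupling:
  fixes \<alpha> \<beta> :: "'a::{metric_space,second_countable_topology} measure"
  assumes p: "prob_space \<alpha>" "prob_space \<beta>" and s: "sets \<alpha> = sets borel" "sets \<beta> = sets borel"
  obtains \<gamma> where "\<gamma> \<in> couplings \<alpha> \<beta>" "cost \<gamma> = (\<integral>\<^sup>+ a. \<integral>\<^sup>+ b. ennreal (dist a b) \<partial>\<beta> \<partial>\<alpha>)"
proof -
  interpret \<alpha>: prob_space \<alpha> by fact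
  interpret \<beta>: prob_space \<beta> by fact
  note [measurable_cong] = s
  have "density (\<alpha> \<Otimes>\<^sub>M \<beta>) (\<lambda>p. 1) \<in> couplings \<alpha> \<beta>"
    using density_couplings[OF p s, of "\<lambda>_ _. 1"] by (simp add: \<alpha>.emeasure_space_1 \<beta>.emeasure_space_1)
  moreover have "cost (density (\<alpha> \<Otimes>\<^sub>M \<beta>) (\<lambda>p. 1)) = (\<integral>\<^sup>+ a. \<integral>\<^sup>+ b. ennreal (dist a b) \<partial>\<beta> \<partial>\<alpha>)"
    unfolding cost_def density_1 by (subst \<beta>.nn_integral_fst[symmetric]) auto
  ultimately show thesis by (rule that)
qed

lemma W_le_product:
  fixes \<alpha> \<beta> :: "'a::{metric_space,second_countable_topology} measure"
  assumes "prob_space \<alpha>" "prob_space \<beta>" "sets \<alpha> = sets borel" "sets \<beta> = sets borel"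
  shows "W \<alpha> \<beta> \<le> (\<integral>\<^sup>+ a. \<integral>\<^sup>+ b. ennreal (dist a b) \<partial>\<beta> \<partial>\<alpha>)"
  by (rule product_coupling[OF assms]) (metis INF_lower W_eq_INF_cost)

lemma product_dist_le:
  fixes \<alpha> \<beta> :: "'a::{metric_space,second_countable_topology} measure"
  assumes p: "prob_space \<alpha>" "prob_space \<beta>" and s: "sets \<alpha> = sets borel" "sets \<beta> = sets borel"
  shows "(\<integral>\<^sup>+ a. \<integral>\<^sup>+ b. ennreal (dist a b) \<partial>\<beta> \<partial>\<alpha>)
    \<le> (\<integral>\<^sup>+ a. ennreal (dist a x0) \<partial>\<alpha>) + (\<integral>\<^sup>+ a. ennreal (dist a x0) \<partial>\<beta>)"
proof -
  interpret \<alpha>: prob_space \<alpha> by fact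
  interpret \<beta>: prob_space \<beta> by fact
  note [measurable_cong] = s
  have "(\<integral>\<^sup>+ a. \<integral>\<^sup>+ b. ennreal (dist a b) \<partial>\<beta> \<partial>\<alpha>) \<le> (\<integral>\<^sup>+ a. \<integral>\<^sup>+ b. ennreal (dist a x0) + ennreal (dist b x0) \<partial>\<beta> \<partial>\<alpha>)"
    by (intro nn_integral_mono) (simp add: dist_triangle2 flip: ennreal_plus)
  also have "\<dots> = (\<integral>\<^sup>+ a. ennreal (dist a x0) \<partial>\<alpha>) + (\<integral>\<^sup>+ a. ennreal (dist a x0) \<partial>\<beta>)"
    by (simp add: nn_integral_add \<alpha>.emeasure_space_1 \<beta>.emeasure_space_1)
  finally show ?thesis .
qed

lemma borel_measurable_mean_dist_to:
  fixes \<beta> :: "'a::{metric_space,second_countable_topology} measure"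
  assumes "prob_space \<beta>" and [measurable_cong]: "sets \<beta> = sets borel"
  shows "(\<lambda>a. \<integral>\<^sup>+ b. ennreal (dist a b) \<partial>\<beta>) \<in> borel_measurable borel"
proof -
  interpret prob_space \<beta> by fact
  show ?thesis using borel_measurable_nn_integral_fst[of "\<lambda>p. ennreal (dist (fst p) (snd p))" borel] by simp
qed

text \<open>For two independent copies (y, y') and (z, z') of a coupling, the distance of y and z is
  at most that of y' and z' plus the two displacements. Each displacement integrates to the cost of
  the coupling, hence the factor 2. Used in both directions, this bounds the change of the
  denominators.\<close>

lemma product_dist_le_W:
  fixes \<nu> \<nu>' :: "'a::{metric_space,second_countable_topology} measure"
  assumes p: "prob_space \<nu>" "prob_space \<nu>'" and s: "sets \<nu> = sets borel" "sets \<nu>' = sets borel"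
    and fin: "W \<nu> \<nu>' < top"
  shows "(\<integral>\<^sup>+ y. \<integral>\<^sup>+ z. ennreal (dist y z) \<partial>\<nu> \<partial>\<nu>) \<le> (\<integral>\<^sup>+ y. \<integral>\<^sup>+ z. ennreal (dist y z) \<partial>\<nu>' \<partial>\<nu>') + 2 * W \<nu> \<nu>'"
proof -
  let ?D = "\<lambda>\<nu>::'a measure. \<integral>\<^sup>+ y. \<integral>\<^sup>+ z. ennreal (dist y z) \<partial>\<nu> \<partial>\<nu>"
  have *: "?D \<nu> \<le> ?D \<nu>' + 2 * cost \<gamma>" if \<gamma>: "\<gamma> \<in> couplings \<nu> \<nu>'" for \<gamma>
  proof -
    note [measurable_cong] = couplingsD(2)[OF \<gamma>] s
    interpret \<gamma>: prob_space \<gamma> using couplingsD[OF \<gamma>] by simp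
    note [measurable] = borel_measurable_mean_dist_to[OF p(1) s(1)] borel_measurable_mean_dist_to[OF p(2) s(2)]
    have "?D \<nu> = (\<integral>\<^sup>+ p. \<integral>\<^sup>+ z. ennreal (dist (fst p) z) \<partial>\<nu> \<partial>\<gamma>)"
      by (rule couplings_marginals(1)[OF \<gamma>, symmetric]) measurable
    also have "\<dots> = (\<integral>\<^sup>+ p. \<integral>\<^sup>+ q. ennreal (dist (fst p) (fst q)) \<partial>\<gamma> \<partial>\<gamma>)"
      by (intro nn_integral_cong couplings_marginals(1)[OF \<gamma>, symmetric]) measurable
    also have "\<dots> \<le> (\<integral>\<^sup>+ p. \<integral>\<^sup>+ q. ennreal (dist (fst p) (snd p)) + ennreal (dist (snd p) (snd q)) + ennreal (dist (fst q) (snd q)) \<partial>\<gamma> \<partial>\<gamma>)"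
    proof (intro nn_integral_mono)
      fix p q :: "'a \<times> 'a"
      have "dist (fst p) (fst q) \<le> dist (fst p) (snd p) + dist (snd p) (snd q) + dist (fst q) (snd q)"
        using dist_triangle[of "fst p" "fst q" "snd p"] dist_triangle2[of "snd p" "fst q" "snd q"] by linarith
      then show "ennreal (dist (fst p) (fst q)) \<le> ennreal (dist (fst p) (snd p)) + ennreal (dist (snd p) (snd q)) + ennreal (dist (fst q) (snd q))"
        by (simp add: ennreal_leI flip: ennreal_plus)
    qed
    also have "\<dots> = (\<integral>\<^sup>+ p. ennreal (dist (fst p) (snd p)) + (\<integral>\<^sup>+ z. ennreal (dist (snd p) z) \<partial>\<nu>') + cost \<gamma> \<partial>\<gamma>)"
      using couplings_marginals(2)[OF \<gamma>, of "\<lambda>z. ennreal (dist _ z)"]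
      by (intro nn_integral_cong) (simp add: nn_integral_add \<gamma>.emeasure_space_1 cost_def)
    also have "\<dots> = cost \<gamma> + (\<integral>\<^sup>+ p. \<integral>\<^sup>+ z. ennreal (dist (snd p) z) \<partial>\<nu>' \<partial>\<gamma>) + cost \<gamma>"
    proof -
      have [measurable]: "(\<lambda>p. \<integral>\<^sup>+ z. ennreal (dist (snd p) z) \<partial>\<nu>') \<in> borel_measurable \<gamma>"
        by (rule measurable_compose[where f=snd and N=borel]) measurable
      show ?thesis by (simp add: nn_integral_add \<gamma>.emeasure_space_1 flip: cost_def)
    qed
    also have "(\<integral>\<^sup>+ p. \<integral>\<^sup>+ z. ennreal (dist (snd p) z) \<partial>\<nu>' \<partial>\<gamma>) = ?D \<nu>'"
      by (rule couplings_marginals(2)[OF \<gamma>]) measurable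
    finally show ?thesis unfolding mult_2 by (simp add: ac_simps)
  qed
  show ?thesis
  proof (rule ennreal_le_epsilon)
    fix e :: real assume e: "0 < e"
    have "W \<nu> \<nu>' < W \<nu> \<nu>' + ennreal (e / 2)" using fin e by (intro ennreal_less_add_pos) auto
    then obtain \<gamma> where \<gamma>: "\<gamma> \<in> couplings \<nu> \<nu>'" "cost \<gamma> < W \<nu> \<nu>' + ennreal (e / 2)"
      by (rule W_less_imp_coupling)
    have "?D \<nu> \<le> ?D \<nu>' + 2 * (W \<nu> \<nu>' + ennreal (e / 2))"
      using *[OF \<gamma>(1)] \<gamma>(2) by (meson add_left_mono less_imp_le mult_left_mono order_trans zero_le)
    also have "\<dots> = ?D \<nu>' + 2 * W \<nu> \<nu>' + (ennreal (e / 2) + ennreal (e / 2))" by (simp add: mult_2 ac_simps)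
    also have "ennreal (e / 2) + ennreal (e / 2) = ennreal e" using e by (simp flip: ennreal_plus)
    finally show "?D \<nu> \<le> ?D \<nu>' + 2 * W \<nu> \<nu>' + ennreal e" .
  qed
qed

text \<open>Almost every y, hence at least one, has mean distance 0 to \<nu>, and then \<nu> is
  concentrated at this y. The contrapositive makes the denominators positive for measures that are
  not Dirac.\<close>

lemma product_dist_eq_0_imp_return:
  fixes \<nu> :: "'a::{metric_space,second_countable_topology} measure"
  assumes "prob_space \<nu>" and s [measurable_cong]: "sets \<nu> = sets borel"
    and 0: "(\<integral>\<^sup>+ y. \<integral>\<^sup>+ z. ennreal (dist y z) \<partial>\<nu> \<partial>\<nu>) = 0"
  shows "\<exists>x. \<nu> = return borel x"
proof -
  interpret prob_space \<nu> by fact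
  note [measurable] = borel_measurable_mean_dist_to[OF assms(1,2)]
  have "AE y in \<nu>. (\<integral>\<^sup>+ z. ennreal (dist y z) \<partial>\<nu>) = 0"
    using 0 by (subst (asm) nn_integral_0_iff_AE) auto
  then have "\<exists>y. (\<integral>\<^sup>+ z. ennreal (dist y z) \<partial>\<nu>) = 0"
    by (rule eventually_happens'[rotated]) (simp add: ae_filter_eq_bot_iff emeasure_space_1)
  then obtain y where "(\<integral>\<^sup>+ z. ennreal (dist y z) \<partial>\<nu>) = 0" by blast
  then have y: "AE z in \<nu>. z = y" by (subst (asm) nn_integral_0_iff_AE) auto
  have "\<nu> = return borel y"
  proof (rule measure_eqI)
    fix A assume "A \<in> sets \<nu>"
    then have [measurable]: "A \<in> sets borel" by (simp add: s)
    have "emeasure \<nu> A = (\<integral>\<^sup>+ z. indicator A z \<partial>\<nu>)" by simp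
    also have "\<dots> = (\<integral>\<^sup>+ z. indicator A y \<partial>\<nu>)"
      by (rule nn_integral_cong_AE) (use y in auto)
    finally show "emeasure \<nu> A = emeasure (return borel y) A" by (simp add: emeasure_space_1)
  qed (simp add: s)
  then show ?thesis by blast
qed

section \<open>Mixtures\<close>

text \<open>The definition provides some base point for each measure. Moving it by the triangle
  inequality lets a single base point serve all four marginals.\<close>

lemma finite_first_moment_imp:
  fixes M :: "'a::{metric_space,second_countable_topology} measure"
  assumes "finite_first_moment M" "prob_space M" and [measurable_cong]: "sets M = sets borel"
  shows "(\<integral>\<^sup>+ x. ennreal (dist x x0) \<partial>M) < \<infinity>"
proof -
  interpret prob_space M by fact
  obtain x1 where x1: "(\<integral>\<^sup>+ x. ennreal (dist x x1) \<partial>M) < \<infinity>"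
    using assms(1) unfolding finite_first_moment_def by blast
  have "(\<integral>\<^sup>+ x. ennreal (dist x x0) \<partial>M) \<le> (\<integral>\<^sup>+ x. ennreal (dist x x1) + ennreal (dist x1 x0) \<partial>M)"
    by (intro nn_integral_mono) (simp add: dist_triangle flip: ennreal_plus)
  also have "\<dots> = (\<integral>\<^sup>+ x. ennreal (dist x x1) \<partial>M) + ennreal (dist x1 x0)"
    by (simp add: nn_integral_add emeasure_space_1)
  also have "\<dots> < \<infinity>" using x1 by simp
  finally show ?thesis .
qed

text \<open>This isolates what the estimates need from a joint law and its disintegration: \<nu> is
  the average of the kernel under \<mu>. The finite moment of \<nu> then passes to
  \<open>\<kappa> x\<close> for almost every \<open>x\<close>, which is what the selection results
  require.\<close>

locale mixture =
  fixes \<mu> :: "'a::{metric_space,second_countable_topology} measure" and \<kappa> :: "'a \<Rightarrow> 'a measure"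
    and \<nu> :: "'a measure" and x0 :: 'a
  assumes prob: "prob_space \<mu>" "prob_space \<nu>"
    and sets [measurable_cong]: "sets \<mu> = sets borel" "sets \<nu> = sets borel"
    and kernel: "\<kappa> \<in> borel \<rightarrow>\<^sub>M prob_algebra borel"
    and mix: "\<And>f. f \<in> borel_measurable borel \<Longrightarrow> (\<integral>\<^sup>+ z. f z \<partial>\<nu>) = (\<integral>\<^sup>+ x. \<integral>\<^sup>+ z. f z \<partial>\<kappa> x \<partial>\<mu>)"
    and moments: "(\<integral>\<^sup>+ x. ennreal (dist x x0) \<partial>\<mu>) < \<infinity>" "(\<integral>\<^sup>+ x. ennreal (dist x x0) \<partial>\<nu>) < \<infinity>"
begin

sublocale \<mu>: prob_space \<mu> by (rule prob)
sublocale \<nu>: prob_space \<nu> by (rule prob)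

lemma \<kappa>_prob: "prob_space (\<kappa> x)" "sets (\<kappa> x) = sets borel"
  using prob_algebraD[OF kernel] by auto

lemma moment_measurable: "(\<lambda>x. \<integral>\<^sup>+ z. ennreal (dist z x0) \<partial>\<kappa> x) \<in> borel_measurable borel"
  by (rule measurable_compose[OF measurable_prob_algebraD[OF kernel] nn_integral_measurable_subprob_algebra]) measurable

lemma AE_moment: "AE x in \<mu>. (\<integral>\<^sup>+ z. ennreal (dist z x0) \<partial>\<kappa> x) < \<infinity>"
proof -
  note [measurable] = moment_measurable
  have "(\<integral>\<^sup>+ x. \<integral>\<^sup>+ z. ennreal (dist z x0) \<partial>\<kappa> x \<partial>\<mu>) \<noteq> \<infinity>"
    using mix[of "\<lambda>z. ennreal (dist z x0)"] moments(2) by simp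
  then have "AE x in \<mu>. (\<integral>\<^sup>+ z. ennreal (dist z x0) \<partial>\<kappa> x) \<noteq> \<infinity>"
    by (intro nn_integral_PInf_AE) auto
  then show ?thesis by (simp add: less_top)
qed

lemma const_kernel: "(\<lambda>_. \<nu>) \<in> M \<rightarrow>\<^sub>M prob_algebra borel"
  by (rule measurable_const) (simp add: space_prob_algebra prob sets)

text \<open>The product coupling bounds each \<open>W (\<kappa> x) \<nu>\<close>, and averaging over
  \<open>x\<close> turns the kernel back into \<nu>. For a positive denominator this says that the
  correlation coefficient is at most 1.\<close>

lemma avg_W_le: "(\<integral>\<^sup>+ x. W (\<kappa> x) \<nu> \<partial>\<mu>) \<le> (\<integral>\<^sup>+ y. \<integral>\<^sup>+ z. ennreal (dist y z) \<partial>\<nu> \<partial>\<nu>)"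
proof -
  have "(\<integral>\<^sup>+ x. W (\<kappa> x) \<nu> \<partial>\<mu>) \<le> (\<integral>\<^sup>+ x. \<integral>\<^sup>+ y. \<integral>\<^sup>+ z. ennreal (dist y z) \<partial>\<nu> \<partial>\<kappa> x \<partial>\<mu>)"
    by (intro nn_integral_mono W_le_product \<kappa>_prob prob sets)
  also have "\<dots> = (\<integral>\<^sup>+ y. \<integral>\<^sup>+ z. ennreal (dist y z) \<partial>\<nu> \<partial>\<nu>)"
    by (intro mix[symmetric] borel_measurable_mean_dist_to prob sets)
  finally show ?thesis .
qed

lemma mean_dist_finite: "(\<integral>\<^sup>+ y. \<integral>\<^sup>+ z. ennreal (dist y z) \<partial>\<nu> \<partial>\<nu>) < top"
  using product_dist_le[OF prob(2) prob(2) sets(2) sets(2), of x0] moments(2)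
  by (simp add: order_le_less_trans)

end

lemma mixture_disintegration:
  fixes \<pi> :: "('a::{metric_space,second_countable_topology} \<times> 'a) measure"
  assumes "prob_space \<pi>" and s: "sets \<pi> = sets (borel :: ('a \<times> 'a) measure)"
    and \<mu>: "\<mu> = distr \<pi> borel fst" and \<nu>: "\<nu> = distr \<pi> borel snd"
    and m: "finite_first_moment \<mu>" "finite_first_moment \<nu>"
    and d: "is_disintegration \<pi> \<mu> \<kappa>"
  shows "mixture \<mu> \<kappa> \<nu> x0"
proof -
  interpret prob_space \<pi> by fact
  have [measurable_cong]: "sets \<pi> = sets (borel \<Otimes>\<^sub>M borel)" unfolding borel_prod by (rule s)
  have \<kappa>: "prob_space (\<kappa> x)" "sets (\<kappa> x) = sets borel" for x
    using d unfolding is_disintegration_def by auto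
  have kernel: "\<kappa> \<in> borel \<rightarrow>\<^sub>M prob_algebra borel"
    by (intro measurable_prob_algebraI measurable_subprob_algebra)
       (use d \<kappa> in \<open>auto simp: is_disintegration_def intro: prob_space_imp_subprob_space\<close>)
  have p: "prob_space \<mu>" "prob_space \<nu>" unfolding \<mu> \<nu> by (rule prob_space_distr; measurable)+
  have sm: "sets \<mu> = sets borel" "sets \<nu> = sets borel" unfolding \<mu> \<nu> by simp_all
  note [measurable_cong] = sm
  have k\<mu>: "\<kappa> \<in> \<mu> \<rightarrow>\<^sub>M subprob_algebra borel"
    using measurable_prob_algebraD[OF kernel] by (simp cong: measurable_cong_sets)
  have sp: "space \<mu> \<noteq> {}" unfolding \<mu> by simp
  \<comment> \<open>The disintegration identity on rectangles \<open>UNIV \<times> B\<close>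
    determines the second marginal; integrals of functions then follow from the rule for
    \<open>bind\<close>.\<close>
  have "\<nu> = \<mu> \<bind> \<kappa>"
  proof (rule measure_eqI)
    show "sets \<nu> = sets (\<mu> \<bind> \<kappa>)" using sets_bind[OF \<kappa>(2) sp] sm by simp
    fix B assume "B \<in> sets \<nu>"
    then have B [measurable]: "B \<in> sets borel" by (simp add: sm)
    have "emeasure \<nu> B = emeasure \<pi> (UNIV \<times> B)"
      unfolding \<nu> using sets_eq_imp_space_eq[OF s]
      by (subst emeasure_distr) (auto intro!: arg_cong[where f="emeasure \<pi>"])
    also have "\<dots> = (\<integral>\<^sup>+ x. indicator UNIV x * emeasure (\<kappa> x) B \<partial>\<mu>)"
      using d B unfolding is_disintegration_def by (metis UNIV_I sets.top space_borel)
    also have "\<dots> = emeasure (\<mu> \<bind> \<kappa>) B"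
      by (subst emeasure_bind[OF sp k\<mu> B]) simp
    finally show "emeasure \<nu> B = emeasure (\<mu> \<bind> \<kappa>) B" .
  qed
  then have "(\<integral>\<^sup>+ z. f z \<partial>\<nu>) = (\<integral>\<^sup>+ x. \<integral>\<^sup>+ z. f z \<partial>\<kappa> x \<partial>\<mu>)" if "f \<in> borel_measurable borel" for f
    using nn_integral_bind[OF that k\<mu>] by simp
  then show ?thesis
    by (intro mixture.intro p sm kernel finite_first_moment_imp m) auto
qed

section \<open>Transfer of the estimates along a coupling of the first marginals\<close>

locale two_mixtures = X: mixture \<mu> \<kappa> \<nu> x0 + Y: mixture \<mu>' \<kappa>' \<nu>' x0
  for \<mu> \<mu>' :: "'a::{metric_space,second_countable_topology} measure" and \<kappa> \<kappa>' \<nu> \<nu>' x0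
begin

lemma
  assumes \<gamma>: "\<gamma> \<in> couplings \<mu> \<mu>'"
  shows W_mixture_le: "W \<nu> \<nu>' \<le> (\<integral>\<^sup>+ p. W (\<kappa> (fst p)) (\<kappa>' (snd p)) \<partial>\<gamma>)"
    and avg_W_le1: "(\<integral>\<^sup>+ x. W (\<kappa> x) \<nu> \<partial>\<mu>)
      \<le> (\<integral>\<^sup>+ p. W (\<kappa> (fst p)) (\<kappa>' (snd p)) \<partial>\<gamma>) + (\<integral>\<^sup>+ x. W (\<kappa>' x) \<nu>' \<partial>\<mu>') + W \<nu> \<nu>'"
    and avg_W_le2: "(\<integral>\<^sup>+ x. W (\<kappa>' x) \<nu>' \<partial>\<mu>')
      \<le> (\<integral>\<^sup>+ p. W (\<kappa> (fst p)) (\<kappa>' (snd p)) \<partial>\<gamma>) + (\<integral>\<^sup>+ x. W (\<kappa> x) \<nu> \<partial>\<mu>) + W \<nu> \<nu>'"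
proof -
  have s\<gamma> [measurable_cong]: "sets \<gamma> = sets (borel \<Otimes>\<^sub>M borel)" by (rule couplingsD(2)[OF \<gamma>])
  interpret \<gamma>: prob_space \<gamma> using couplingsD[OF \<gamma>] by simp
  have K1: "(\<lambda>p. \<kappa> (fst p)) \<in> borel \<Otimes>\<^sub>M borel \<rightarrow>\<^sub>M prob_algebra borel"
    by (rule measurable_compose[OF measurable_fst X.kernel])
  have K2: "(\<lambda>p. \<kappa>' (snd p)) \<in> borel \<Otimes>\<^sub>M borel \<rightarrow>\<^sub>M prob_algebra borel"
    by (rule measurable_compose[OF measurable_snd Y.kernel])
  have AE1: "AE p in \<gamma>. (\<integral>\<^sup>+ z. ennreal (dist z x0) \<partial>\<kappa> (fst p)) < \<infinity>"
    by (rule AE_distrD[where M'=borel and f=fst, OF _ X.AE_moment[folded couplingsD(3)[OF \<gamma>]]]) measurable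
  have AE2: "AE p in \<gamma>. (\<integral>\<^sup>+ z. ennreal (dist z x0) \<partial>\<kappa>' (snd p)) < \<infinity>"
    by (rule AE_distrD[where M'=borel and f=snd, OF _ Y.AE_moment[folded couplingsD(4)[OF \<gamma>]]]) measurable
  \<comment> \<open>Measurable substitutes for the three \<open>W\<close> terms. They agree with
    \<open>W\<close> where the kernels have finite moments, thus almost everywhere, since the
    marginals of \<gamma> carry null sets over.\<close>
  obtain g where g [measurable]: "g \<in> borel_measurable (borel \<Otimes>\<^sub>M borel)"
    and gW: "\<And>p x0. (\<integral>\<^sup>+ z. ennreal (dist z x0) \<partial>\<kappa> (fst p)) < \<infinity> \<Longrightarrow>
      (\<integral>\<^sup>+ z. ennreal (dist z x0) \<partial>\<kappa>' (snd p)) < \<infinity> \<Longrightarrow> g p = W (\<kappa> (fst p)) (\<kappa>' (snd p))"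
    by (rule measurable_W_version[OF K1 K2]) (simp add: space_pair_measure)
  have gAE: "AE p in \<gamma>. g p = W (\<kappa> (fst p)) (\<kappa>' (snd p))"
    using AE1 AE2 by eventually_elim (rule gW)
  have gint: "(\<integral>\<^sup>+ p. W (\<kappa> (fst p)) (\<kappa>' (snd p)) \<partial>\<gamma>) = (\<integral>\<^sup>+ p. g p \<partial>\<gamma>)"
    by (rule nn_integral_cong_AE) (use gAE in auto)
  obtain h where h [measurable]: "h \<in> borel_measurable borel"
    and hW: "\<And>x x0. (\<integral>\<^sup>+ z. ennreal (dist z x0) \<partial>\<kappa> x) < \<infinity> \<Longrightarrow>
      (\<integral>\<^sup>+ z. ennreal (dist z x0) \<partial>\<nu>) < \<infinity> \<Longrightarrow> h x = W (\<kappa> x) \<nu>"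
    by (rule measurable_W_version[OF X.kernel X.const_kernel]) simp
  obtain h' where h' [measurable]: "h' \<in> borel_measurable borel"
    and h'W: "\<And>x x0. (\<integral>\<^sup>+ z. ennreal (dist z x0) \<partial>\<kappa>' x) < \<infinity> \<Longrightarrow>
      (\<integral>\<^sup>+ z. ennreal (dist z x0) \<partial>\<nu>') < \<infinity> \<Longrightarrow> h' x = W (\<kappa>' x) \<nu>'"
    by (rule measurable_W_version[OF Y.kernel Y.const_kernel]) simp
  have "(\<integral>\<^sup>+ x. W (\<kappa> x) \<nu> \<partial>\<mu>) = (\<integral>\<^sup>+ x. h x \<partial>\<mu>)"
    by (rule nn_integral_cong_AE) (use X.AE_moment in \<open>eventually_elim, simp add: hW[OF _ X.moments(2)]\<close>)
  also have "\<dots> = (\<integral>\<^sup>+ p. h (fst p) \<partial>\<gamma>)"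
    by (rule couplings_marginals(1)[OF \<gamma>, symmetric]) measurable
  finally have hint: "(\<integral>\<^sup>+ x. W (\<kappa> x) \<nu> \<partial>\<mu>) = (\<integral>\<^sup>+ p. h (fst p) \<partial>\<gamma>)" .
  have "(\<integral>\<^sup>+ x. W (\<kappa>' x) \<nu>' \<partial>\<mu>') = (\<integral>\<^sup>+ x. h' x \<partial>\<mu>')"
    by (rule nn_integral_cong_AE) (use Y.AE_moment in \<open>eventually_elim, simp add: h'W[OF _ Y.moments(2)]\<close>)
  also have "\<dots> = (\<integral>\<^sup>+ p. h' (snd p) \<partial>\<gamma>)"
    by (rule couplings_marginals(2)[OF \<gamma>, symmetric]) measurable
  finally have h'int: "(\<integral>\<^sup>+ x. W (\<kappa>' x) \<nu>' \<partial>\<mu>') = (\<integral>\<^sup>+ p. h' (snd p) \<partial>\<gamma>)" .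
  have triangle: "W a b \<le> W a c + W c d + W b d" for a b c d :: "'a measure"
    using W_triangle[of a b c] W_triangle[of c b d] W_commute[of b d]
    by (metis add.assoc add_left_mono order_trans)
  have "(\<integral>\<^sup>+ p. h (fst p) \<partial>\<gamma>) \<le> (\<integral>\<^sup>+ p. g p + h' (snd p) + W \<nu> \<nu>' \<partial>\<gamma>)"
  proof (rule nn_integral_mono_AE, use AE1 AE2 in eventually_elim)
    case (elim p)
    then show ?case
      using triangle[of "\<kappa> (fst p)" \<nu> "\<kappa>' (snd p)" \<nu>'] gW[of p x0] hW[OF _ X.moments(2), of "fst p"] h'W[OF _ Y.moments(2), of "snd p"] by simp
  qed
  also have "\<dots> = (\<integral>\<^sup>+ p. g p \<partial>\<gamma>) + (\<integral>\<^sup>+ p. h' (snd p) \<partial>\<gamma>) + W \<nu> \<nu>'"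
    by (simp add: nn_integral_add \<gamma>.emeasure_space_1)
  finally show "(\<integral>\<^sup>+ x. W (\<kappa> x) \<nu> \<partial>\<mu>)
      \<le> (\<integral>\<^sup>+ p. W (\<kappa> (fst p)) (\<kappa>' (snd p)) \<partial>\<gamma>) + (\<integral>\<^sup>+ x. W (\<kappa>' x) \<nu>' \<partial>\<mu>') + W \<nu> \<nu>'"
    unfolding gint hint h'int .
  have "(\<integral>\<^sup>+ p. h' (snd p) \<partial>\<gamma>) \<le> (\<integral>\<^sup>+ p. g p + h (fst p) + W \<nu> \<nu>' \<partial>\<gamma>)"
  proof (rule nn_integral_mono_AE, use AE1 AE2 in eventually_elim)
    case (elim p)
    then show ?case
      using triangle[of "\<kappa>' (snd p)" \<nu>' "\<kappa> (fst p)" \<nu>] gW[of p x0] hW[OF _ X.moments(2), of "fst p"] h'W[OF _ Y.moments(2), of "snd p"]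
      by (simp add: W_commute)
  qed
  also have "\<dots> = (\<integral>\<^sup>+ p. g p \<partial>\<gamma>) + (\<integral>\<^sup>+ p. h (fst p) \<partial>\<gamma>) + W \<nu> \<nu>'"
    by (simp add: nn_integral_add \<gamma>.emeasure_space_1)
  finally show "(\<integral>\<^sup>+ x. W (\<kappa>' x) \<nu>' \<partial>\<mu>')
      \<le> (\<integral>\<^sup>+ p. W (\<kappa> (fst p)) (\<kappa>' (snd p)) \<partial>\<gamma>) + (\<integral>\<^sup>+ x. W (\<kappa> x) \<nu> \<partial>\<mu>) + W \<nu> \<nu>'"
    unfolding gint hint h'int .
  show "W \<nu> \<nu>' \<le> (\<integral>\<^sup>+ p. W (\<kappa> (fst p)) (\<kappa>' (snd p)) \<partial>\<gamma>)"
  proof (rule ennreal_le_epsilon)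
    fix e :: real assume e: "0 < e"
    \<comment> \<open>Mixing these conditional couplings over \<gamma> yields \<theta>, whose
      marginals are the mixtures of the kernels, that is \<nu> and \<nu>'. Measurability of the
      selection is what allows \<theta> to be formed.\<close>
    obtain \<Gamma> where \<Gamma>: "\<Gamma> \<in> borel \<Otimes>\<^sub>M borel \<rightarrow>\<^sub>M prob_algebra (borel \<Otimes>\<^sub>M borel)"
      and \<Gamma>c: "\<And>p. \<Gamma> p \<in> couplings (\<kappa> (fst p)) (\<kappa>' (snd p))"
      and \<Gamma>e: "\<And>p x0. (\<integral>\<^sup>+ z. ennreal (dist z x0) \<partial>\<kappa> (fst p)) < \<infinity> \<Longrightarrow>
      (\<integral>\<^sup>+ z. ennreal (dist z x0) \<partial>\<kappa>' (snd p)) < \<infinity> \<Longrightarrow> cost (\<Gamma> p) \<le> W (\<kappa> (fst p)) (\<kappa>' (snd p)) + ennreal e"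
      by (rule measurable_eps_optimal_coupling[OF K1 K2 e]) (simp add: space_pair_measure)
    have \<Gamma>\<gamma>: "\<Gamma> \<in> \<gamma> \<rightarrow>\<^sub>M subprob_algebra (borel \<Otimes>\<^sub>M borel)"
      using measurable_prob_algebraD[OF \<Gamma>] s\<gamma> by (simp cong: measurable_cong_sets)
    have \<gamma>p: "\<gamma> \<in> space (prob_algebra (borel \<Otimes>\<^sub>M borel))"
      by (simp add: space_prob_algebra s\<gamma> \<gamma>.prob_space_axioms)
    define \<theta> where "\<theta> = \<gamma> \<bind> \<Gamma>"
    have \<theta>int: "(\<integral>\<^sup>+ q. f q \<partial>\<theta>) = (\<integral>\<^sup>+ p. \<integral>\<^sup>+ q. f q \<partial>\<Gamma> p \<partial>\<gamma>)" if "f \<in> borel_measurable (borel \<Otimes>\<^sub>M borel)" for f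
      unfolding \<theta>_def by (rule nn_integral_bind[OF that \<Gamma>\<gamma>])
    have s\<theta> [measurable_cong]: "sets \<theta> = sets (borel \<Otimes>\<^sub>M borel)"
      unfolding \<theta>_def by (rule sets_bind'[OF \<gamma>p \<Gamma>])
    have "prob_space \<theta>" unfolding \<theta>_def by (rule prob_space_bind'[OF \<gamma>p \<Gamma>])
    moreover have "distr \<theta> borel fst = \<nu>"
    proof (rule measure_eqI)
      fix A assume "A \<in> sets (distr \<theta> borel fst)"
      then have [measurable]: "A \<in> sets borel" by simp
      have m: "(\<lambda>x. emeasure (\<kappa> x) A) \<in> borel_measurable borel"
        by (rule measurable_emeasure_kernel[OF measurable_prob_algebraD[OF X.kernel]]) measurable
      have "emeasure (distr \<theta> borel fst) A = (\<integral>\<^sup>+ x. indicator A x \<partial>distr \<theta> borel fst)" by simp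
      also have "\<dots> = (\<integral>\<^sup>+ q. indicator A (fst q) \<partial>\<theta>)" by (rule nn_integral_distr) measurable
      also have "\<dots> = (\<integral>\<^sup>+ p. \<integral>\<^sup>+ q. indicator A (fst q) \<partial>\<Gamma> p \<partial>\<gamma>)" by (rule \<theta>int) measurable
      also have "\<dots> = (\<integral>\<^sup>+ p. emeasure (\<kappa> (fst p)) A \<partial>\<gamma>)"
        by (intro nn_integral_cong, subst couplings_marginals(1)[OF \<Gamma>c]) (simp_all add: X.\<kappa>_prob)
      also have "\<dots> = (\<integral>\<^sup>+ x. emeasure (\<kappa> x) A \<partial>\<mu>)" by (rule couplings_marginals(1)[OF \<gamma> m])
      also have "\<dots> = (\<integral>\<^sup>+ x. \<integral>\<^sup>+ z. indicator A z \<partial>\<kappa> x \<partial>\<mu>)" by (simp add: X.\<kappa>_prob)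
      also have "\<dots> = (\<integral>\<^sup>+ z. indicator A z \<partial>\<nu>)" by (rule X.mix[symmetric]) measurable
      also have "\<dots> = emeasure \<nu> A" by (rule nn_integral_indicator) (simp add: X.sets)
      finally show "emeasure (distr \<theta> borel fst) A = emeasure \<nu> A" .
    qed (simp add: X.sets)
    moreover have "distr \<theta> borel snd = \<nu>'"
    proof (rule measure_eqI)
      fix A assume "A \<in> sets (distr \<theta> borel snd)"
      then have [measurable]: "A \<in> sets borel" by simp
      have m: "(\<lambda>x. emeasure (\<kappa>' x) A) \<in> borel_measurable borel"
        by (rule measurable_emeasure_kernel[OF measurable_prob_algebraD[OF Y.kernel]]) measurable
      have "emeasure (distr \<theta> borel snd) A = (\<integral>\<^sup>+ x. indicator A x \<partial>distr \<theta> borel snd)" by simp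
      also have "\<dots> = (\<integral>\<^sup>+ q. indicator A (snd q) \<partial>\<theta>)" by (rule nn_integral_distr) measurable
      also have "\<dots> = (\<integral>\<^sup>+ p. \<integral>\<^sup>+ q. indicator A (snd q) \<partial>\<Gamma> p \<partial>\<gamma>)" by (rule \<theta>int) measurable
      also have "\<dots> = (\<integral>\<^sup>+ p. emeasure (\<kappa>' (snd p)) A \<partial>\<gamma>)"
        by (intro nn_integral_cong, subst couplings_marginals(2)[OF \<Gamma>c]) (simp_all add: Y.\<kappa>_prob)
      also have "\<dots> = (\<integral>\<^sup>+ x. emeasure (\<kappa>' x) A \<partial>\<mu>')" by (rule couplings_marginals(2)[OF \<gamma> m])
      also have "\<dots> = (\<integral>\<^sup>+ x. \<integral>\<^sup>+ z. indicator A z \<partial>\<kappa>' x \<partial>\<mu>')" by (simp add: Y.\<kappa>_prob)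
      also have "\<dots> = (\<integral>\<^sup>+ z. indicator A z \<partial>\<nu>')" by (rule Y.mix[symmetric]) measurable
      also have "\<dots> = emeasure \<nu>' A" by (rule nn_integral_indicator) (simp add: Y.sets)
      finally show "emeasure (distr \<theta> borel snd) A = emeasure \<nu>' A" .
    qed (simp add: Y.sets)
    ultimately have "\<theta> \<in> couplings \<nu> \<nu>'" using s\<theta> by (simp add: couplings_def flip: borel_prod)
    then have "W \<nu> \<nu>' \<le> cost \<theta>" unfolding W_eq_INF_cost by (rule INF_lower)
    also have "\<dots> = (\<integral>\<^sup>+ p. cost (\<Gamma> p) \<partial>\<gamma>)" unfolding cost_def by (rule \<theta>int) measurable
    also have "\<dots> \<le> (\<integral>\<^sup>+ p. g p + ennreal e \<partial>\<gamma>)"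
    proof (rule nn_integral_mono_AE, use AE1 AE2 in eventually_elim)
      case (elim p)
      then show ?case using \<Gamma>e[of p x0] gW[of p x0] by simp
    qed
    also have "\<dots> = (\<integral>\<^sup>+ p. g p \<partial>\<gamma>) + ennreal e" by (simp add: nn_integral_add \<gamma>.emeasure_space_1)
    finally show "W \<nu> \<nu>' \<le> (\<integral>\<^sup>+ p. W (\<kappa> (fst p)) (\<kappa>' (snd p)) \<partial>\<gamma>) + ennreal e" unfolding gint .
  qed
qed

lemma W_integral_le_AW:
  "(\<integral>\<^sup>+ p. W (\<kappa> (fst p)) (\<kappa>' (snd p)) \<partial>\<gamma>)
    \<le> (\<integral>\<^sup>+ p. (ennreal (dist (fst p) (snd p)) + W (\<kappa> (fst p)) (\<kappa>' (snd p))) \<partial>\<gamma>)"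
  by (intro nn_integral_mono) simp

lemma W_le_AW: "W \<nu> \<nu>' \<le> AW \<mu> \<kappa> \<mu>' \<kappa>'"
  unfolding AW_def by (intro INF_greatest order_trans[OF W_mixture_le W_integral_le_AW])

text \<open>Under the product coupling, both the distance and the inner \<open>W\<close> are
  controlled by moments about \<open>x0\<close>, and the moments of the kernels average to those of
  \<nu> and \<nu>'. Without finiteness, \<open>enn2real\<close> would turn an infinite value into
  0.\<close>

lemma AW_finite: "AW \<mu> \<kappa> \<mu>' \<kappa>' < top"
proof -
  obtain \<gamma> where \<gamma>: "\<gamma> \<in> couplings \<mu> \<mu>'" and c: "cost \<gamma> = (\<integral>\<^sup>+ a. \<integral>\<^sup>+ b. ennreal (dist a b) \<partial>\<mu>' \<partial>\<mu>)"
    by (rule product_coupling[OF X.prob(1) Y.prob(1) X.sets(1) Y.sets(1)])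
  note [measurable_cong] = couplingsD(2)[OF \<gamma>]
  note m [measurable] = X.moment_measurable Y.moment_measurable
  let ?m = "\<lambda>x. \<integral>\<^sup>+ z. ennreal (dist z x0) \<partial>\<kappa> x" and ?m' = "\<lambda>x. \<integral>\<^sup>+ z. ennreal (dist z x0) \<partial>\<kappa>' x"
  have [measurable]: "(\<lambda>p. ?m (fst p)) \<in> borel_measurable \<gamma>"
    by (rule measurable_compose[OF _ m(1)]) measurable
  have [measurable]: "(\<lambda>p. ?m' (snd p)) \<in> borel_measurable \<gamma>"
    by (rule measurable_compose[OF _ m(2)]) measurable
  have "AW \<mu> \<kappa> \<mu>' \<kappa>' \<le> (\<integral>\<^sup>+ p. (ennreal (dist (fst p) (snd p)) + W (\<kappa> (fst p)) (\<kappa>' (snd p))) \<partial>\<gamma>)"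
    unfolding AW_def by (rule INF_lower[OF \<gamma>])
  also have "\<dots> \<le> (\<integral>\<^sup>+ p. ennreal (dist (fst p) (snd p)) + (?m (fst p) + ?m' (snd p)) \<partial>\<gamma>)"
    by (intro nn_integral_mono add_left_mono order_trans[OF W_le_product product_dist_le] X.\<kappa>_prob Y.\<kappa>_prob)
  also have "\<dots> = cost \<gamma> + ((\<integral>\<^sup>+ p. ?m (fst p) \<partial>\<gamma>) + (\<integral>\<^sup>+ p. ?m' (snd p) \<partial>\<gamma>))"
    by (simp add: nn_integral_add cost_def)
  also have "\<dots> = cost \<gamma> + ((\<integral>\<^sup>+ z. ennreal (dist z x0) \<partial>\<nu>) + (\<integral>\<^sup>+ z. ennreal (dist z x0) \<partial>\<nu>'))"
    using couplings_marginals(1)[OF \<gamma> m(1)] couplings_marginals(2)[OF \<gamma> m(2)]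
      X.mix[of "\<lambda>z. ennreal (dist z x0)"] Y.mix[of "\<lambda>z. ennreal (dist z x0)"] by simp
  also have "\<dots> < top"
    using product_dist_le[OF X.prob(1) Y.prob(1) X.sets(1) Y.sets(1), of x0] X.moments Y.moments
    by (simp add: c order_le_less_trans)
  finally show ?thesis .
qed

lemma W_finite: "W \<nu> \<nu>' < top"
  using W_le_AW AW_finite by (rule order_le_less_trans)

lemma avg_W_le_AW:
  "(\<integral>\<^sup>+ x. W (\<kappa> x) \<nu> \<partial>\<mu>) \<le> AW \<mu> \<kappa> \<mu>' \<kappa>' + ((\<integral>\<^sup>+ x. W (\<kappa>' x) \<nu>' \<partial>\<mu>') + W \<nu> \<nu>')"
  "(\<integral>\<^sup>+ x. W (\<kappa>' x) \<nu>' \<partial>\<mu>') \<le> AW \<mu> \<kappa> \<mu>' \<kappa>' + ((\<integral>\<^sup>+ x. W (\<kappa> x) \<nu> \<partial>\<mu>) + W \<nu> \<nu>')"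
proof -
  \<comment> \<open>Moving the finite \<open>c\<close> to the left leaves a lower bound for each
    integral alone, which survives the infimum over \<gamma>.\<close>
  have *: "a \<le> AW \<mu> \<kappa> \<mu>' \<kappa>' + c" if "c < top"
    and "\<And>\<gamma>. \<gamma> \<in> couplings \<mu> \<mu>' \<Longrightarrow> a \<le> (\<integral>\<^sup>+ p. W (\<kappa> (fst p)) (\<kappa>' (snd p)) \<partial>\<gamma>) + c" for a c
  proof -
    have "a - c \<le> AW \<mu> \<kappa> \<mu>' \<kappa>'"
      unfolding AW_def
    proof (rule INF_greatest)
      fix \<gamma> assume "\<gamma> \<in> couplings \<mu> \<mu>'"
      then have "a - c \<le> (\<integral>\<^sup>+ p. W (\<kappa> (fst p)) (\<kappa>' (snd p)) \<partial>\<gamma>)"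
        using that by (auto simp: ennreal_minus_le_iff add.commute)
      then show "a - c \<le> (\<integral>\<^sup>+ p. (ennreal (dist (fst p) (snd p)) + W (\<kappa> (fst p)) (\<kappa>' (snd p))) \<partial>\<gamma>)"
        using W_integral_le_AW by (rule order_trans)
    qed
    then show ?thesis using that(1) by (auto simp: ennreal_minus_le_iff add.commute)
  qed
  have fin: "(\<integral>\<^sup>+ x. W (\<kappa> x) \<nu> \<partial>\<mu>) < top" "(\<integral>\<^sup>+ x. W (\<kappa>' x) \<nu>' \<partial>\<mu>') < top"
    by (rule order_le_less_trans[OF X.avg_W_le X.mean_dist_finite], rule order_le_less_trans[OF Y.avg_W_le Y.mean_dist_finite])
  show "(\<integral>\<^sup>+ x. W (\<kappa> x) \<nu> \<partial>\<mu>) \<le> AW \<mu> \<kappa> \<mu>' \<kappa>' + ((\<integral>\<^sup>+ x. W (\<kappa>' x) \<nu>' \<partial>\<mu>') + W \<nu> \<nu>')"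
    by (rule *) (use fin W_finite avg_W_le1 in \<open>simp_all add: add.assoc\<close>)
  show "(\<integral>\<^sup>+ x. W (\<kappa>' x) \<nu>' \<partial>\<mu>') \<le> AW \<mu> \<kappa> \<mu>' \<kappa>' + ((\<integral>\<^sup>+ x. W (\<kappa> x) \<nu> \<partial>\<mu>) + W \<nu> \<nu>')"
    by (rule *) (use fin W_finite avg_W_le2 in \<open>simp_all add: add.assoc\<close>)
qed

end

theorem mainTheorem8:
  fixes \<pi> \<pi>' :: "('a::polish_space \<times> 'a) measure"
    and \<mu> \<nu> \<mu>' \<nu>' :: "'a measure"
    and \<kappa> \<kappa>' :: "'a \<Rightarrow> 'a measure"
  assumes "prob_space \<pi>" and "sets \<pi> = sets (borel :: ('a \<times> 'a) measure)"
    and "\<mu> = distr \<pi> borel fst" and "\<nu> = distr \<pi> borel snd"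
    and "prob_space \<pi>'" and "sets \<pi>' = sets (borel :: ('a \<times> 'a) measure)"
    and "\<mu>' = distr \<pi>' borel fst" and "\<nu>' = distr \<pi>' borel snd"
    and "finite_first_moment \<mu>" and "finite_first_moment \<nu>"
    and "finite_first_moment \<mu>'" and "finite_first_moment \<nu>'"
    and "is_disintegration \<pi> \<mu> \<kappa>" and "is_disintegration \<pi>' \<mu>' \<kappa>'"
  shows "\<bar>avg_W \<mu> \<kappa> \<nu> - avg_W \<mu>' \<kappa>' \<nu>'\<bar>
           \<le> enn2real (AW \<mu> \<kappa> \<mu>' \<kappa>') + enn2real (W \<nu> \<nu>')
       \<and> enn2real (AW \<mu> \<kappa> \<mu>' \<kappa>') + enn2real (W \<nu> \<nu>') \<le> 2 * enn2real (AW \<mu> \<kappa> \<mu>' \<kappa>')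
       \<and> ((\<forall>x. \<nu> \<noteq> return borel x) \<and> (\<forall>x. \<nu>' \<noteq> return borel x) \<longrightarrow>
           \<bar>Wcorr \<mu> \<kappa> \<nu> - Wcorr \<mu>' \<kappa>' \<nu>'\<bar>
             \<le> (enn2real (AW \<mu> \<kappa> \<mu>' \<kappa>') + enn2real (W \<nu> \<nu>') + \<bar>mean_dist \<nu>' - mean_dist \<nu>\<bar>)
                 / mean_dist \<nu>'
           \<and> (enn2real (AW \<mu> \<kappa> \<mu>' \<kappa>') + enn2real (W \<nu> \<nu>') + \<bar>mean_dist \<nu>' - mean_dist \<nu>\<bar>)
                 / mean_dist \<nu>'
             \<le> (enn2real (AW \<mu> \<kappa> \<mu>' \<kappa>') + 3 * enn2real (W \<nu> \<nu>')) / mean_dist \<nu>'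
           \<and> (enn2real (AW \<mu> \<kappa> \<mu>' \<kappa>') + 3 * enn2real (W \<nu> \<nu>')) / mean_dist \<nu>'
             \<le> 4 * enn2real (AW \<mu> \<kappa> \<mu>' \<kappa>') / mean_dist \<nu>')"
proof -
  \<comment> \<open>Any base point will do, since finiteness of the moments does not depend on
    it.\<close>
  interpret two_mixtures \<mu> \<mu>' \<kappa> \<kappa>' \<nu> \<nu>' undefined
    by (intro two_mixtures.intro mixture_disintegration[of \<pi>] mixture_disintegration[of \<pi>'] assms)
  define a where "a = enn2real (AW \<mu> \<kappa> \<mu>' \<kappa>')"
  define b where "b = enn2real (W \<nu> \<nu>')"
  define A where "A = avg_W \<mu> \<kappa> \<nu>"
  define A' where "A' = avg_W \<mu>' \<kappa>' \<nu>'"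
  define F where "F = mean_dist \<nu>"
  define F' where "F' = mean_dist \<nu>'"
  have fin: "(\<integral>\<^sup>+ x. W (\<kappa> x) \<nu> \<partial>\<mu>) < top" "(\<integral>\<^sup>+ x. W (\<kappa>' x) \<nu>' \<partial>\<mu>') < top"
    by (rule order_le_less_trans[OF X.avg_W_le X.mean_dist_finite], rule order_le_less_trans[OF Y.avg_W_le Y.mean_dist_finite])
  have nonneg: "a \<ge> 0" "b \<ge> 0" "A \<ge> 0" "A' \<ge> 0" "F \<ge> 0" "F' \<ge> 0"
    by (simp_all add: a_def b_def A_def A'_def F_def F'_def avg_W_def mean_dist_def)
  have ea: "AW \<mu> \<kappa> \<mu>' \<kappa>' = ennreal a" and eb: "W \<nu> \<nu>' = ennreal b"
    and eA: "(\<integral>\<^sup>+ x. W (\<kappa> x) \<nu> \<partial>\<mu>) = ennreal A" and eA': "(\<integral>\<^sup>+ x. W (\<kappa>' x) \<nu>' \<partial>\<mu>') = ennreal A'"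
    and eF: "(\<integral>\<^sup>+ y. \<integral>\<^sup>+ z. ennreal (dist y z) \<partial>\<nu> \<partial>\<nu>) = ennreal F"
    and eF': "(\<integral>\<^sup>+ y. \<integral>\<^sup>+ z. ennreal (dist y z) \<partial>\<nu>' \<partial>\<nu>') = ennreal F'"
    using AW_finite W_finite fin X.mean_dist_finite Y.mean_dist_finite
    by (simp_all add: a_def b_def A_def A'_def F_def F'_def avg_W_def mean_dist_def)
  have ba: "b \<le> a" using W_le_AW nonneg by (simp add: ea eb)
  have "A \<le> a + (A' + b)" "A' \<le> a + (A + b)"
    using avg_W_le_AW nonneg by (simp_all add: ea eb eA eA' flip: ennreal_plus)
  then have AA: "\<bar>A - A'\<bar> \<le> a + b" by linarith
  have AF: "A \<le> F" using X.avg_W_le nonneg by (simp add: eA eF)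
  have "F \<le> F' + 2 * b"
    using product_dist_le_W[OF X.prob(2) Y.prob(2) X.sets(2) Y.sets(2) W_finite] nonneg
    by (simp add: eF eF' eb flip: ennreal_plus ennreal_mult' ennreal_numeral)
  moreover have "F' \<le> F + 2 * b"
    using product_dist_le_W[OF Y.prob(2) X.prob(2) Y.sets(2) X.sets(2)] W_finite nonneg
    unfolding W_commute[of \<nu>' \<nu>]
    by (simp add: eF eF' eb flip: ennreal_plus ennreal_mult' ennreal_numeral)
  ultimately have FF: "\<bar>F' - F\<bar> \<le> 2 * b" by linarith
  have corr: "\<bar>A / F - A' / F'\<bar> \<le> (a + b + \<bar>F' - F\<bar>) / F' \<and>
     (a + b + \<bar>F' - F\<bar>) / F' \<le> (a + 3 * b) / F' \<and> (a + 3 * b) / F' \<le> 4 * a / F'"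
    if "\<forall>x. \<nu> \<noteq> return borel x" "\<forall>x. \<nu>' \<noteq> return borel x"
  proof -
    have "F \<noteq> 0" using product_dist_eq_0_imp_return[OF X.prob(2) X.sets(2)] that by (auto simp: eF)
    then have F: "F > 0" using nonneg by simp
    have "F' \<noteq> 0" using product_dist_eq_0_imp_return[OF Y.prob(2) Y.sets(2)] that by (auto simp: eF')
    then have F': "F' > 0" using nonneg by simp
    \<comment> \<open>The difference is expanded so that \<open>F\<close> occurs only in the ratio
      \<open>A / F\<close>, which is at most 1.\<close>
    have "A / F - A' / F' = ((A - A') + (A / F) * (F' - F)) / F'"
      using F F' by (simp add: field_simps)
    then have "\<bar>A / F - A' / F'\<bar> = \<bar>(A - A') + (A / F) * (F' - F)\<bar> / F'" using F' by simp
    also have "\<dots> \<le> (a + b + \<bar>F' - F\<bar>) / F'"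
    proof (rule divide_right_mono)
      have "\<bar>(A / F) * (F' - F)\<bar> = (A / F) * \<bar>F' - F\<bar>" using nonneg by (simp add: abs_mult)
      also have "\<dots> \<le> 1 * \<bar>F' - F\<bar>" using AF F by (intro mult_right_mono) auto
      finally show "\<bar>(A - A') + (A / F) * (F' - F)\<bar> \<le> a + b + \<bar>F' - F\<bar>"
        using AA abs_triangle_ineq[of "A - A'" "(A / F) * (F' - F)"] by simp
    qed (use F' in simp)
    finally have "\<bar>A / F - A' / F'\<bar> \<le> (a + b + \<bar>F' - F\<bar>) / F'" .
    \<comment> \<open>The last two bounds compare numerators:
      \<open>a + b + 2 * b = a + 3 * b\<close>, and \<open>b \<le> a\<close>.\<close>
    then show ?thesis using FF ba F' by (auto intro!: divide_right_mono)
  qed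
  show ?thesis
    using AA ba corr unfolding Wcorr_def a_def[symmetric] b_def[symmetric] A_def[symmetric] A'_def[symmetric]
      F_def[symmetric] F'_def[symmetric] by auto
qed

end
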